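(* Let $V\in C^\infty([0,1];\mathbb{R})$. There exist real coefficients $\alpha_{i,n,y}\in\mathbb{R}$, with $i\ge1$, $1\le n\le 2i+1$ and $y\in\{0,1\}$, such that for all $k\ge1$ the corrector defined by $$\mathfrak{C}_ku=\sum_{y\in\{0,1\}}\sum_{i=1}^{k-1}\sum_{n=1}^{2i+1}\alpha_{i,n,y}\,\varphi_{2i+1-n,y}\,\mathcal{I}_{n,y}u$$ satisfies $$\exp(\mathfrak{C}_k)\,H^{2k+2}_{\mathrm{Dir}}\subset H^{2k+2}_V.$$
   Context: $H^m=H^m([0,1])$ is the usual Sobolev space of complex-valued functions on $[0,1]$. For integers $a\ge0$, $H^{2a}_V=\{u\in H^{2a}:\forall\,0\le\ell<a,\ (\partial_x^2+V)^\ell u(0)=(\partial_x^2+V)^\ell u(1)=0\}$, and $H^{2a}_{\mathrm{Dir}}=\{u\in H^{2a}:\forall\,0\le\ell<a,\ \partial_x^{2\ell}u(0)=\partial_x^{2\ell}u(1)=0\}$. The functions $\varphi_{n,y}\in C^\infty([0,1];\mathbb{R})$ ($n\ge0$, $y\in\{0,1\}$) are a fixed family satisfying, for all $z\in\{0,1\}$ and $i\ge0$, $\partial_x^i\varphi_{n,y}(z)=1$ if $z=y$ and $i=n$, and $\partial_x^i\varphi_{n,y}(z)=0$ otherwise. The operators $\mathcal{I}_{n,y}$ are defined inductively for $u\in L^1([0,1])$ by $\mathcal{I}_{0,y}u=u$, $\mathcal{I}_{n+1,y}u(x)=\int_y^x(\mathcal{I}_{n,y}u)(z)\,dz$. The exponential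 of the bounded operator $\mathfrak{C}_k$ is given by its power series (empty sums are $0$, so $\mathfrak{C}_1=0$). *)

theory Defs
  imports "HOL-Analysis.Analysis"
begin

section \<open>Smooth functions\<close>

definition nderiv_within :: "real set \<Rightarrow> nat \<Rightarrow> (real \<Rightarrow> 'b::real_normed_vector) \<Rightarrow> real \<Rightarrow> 'b" where
  "nderiv_within S n f = ((\<lambda>g x. vector_derivative g (at x within S)) ^^ n) f"

text \<open>For a nondegenerate closed interval \<open>S\<close> the derivatives at the endpoints are one-sided, and
  only the values of \<open>f\<close> on \<open>S\<close> matter: with \<open>S = {0..1}\<close> this is membership in
  \<open>C\<^sup>\<infinity>([0,1])\<close>.\<close>
definition smooth_within :: "real set \<Rightarrow> (real \<Rightarrow> 'b::real_normed_vector) \<Rightarrow> bool" where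
  "smooth_within S f \<longleftrightarrow> (\<forall>n. \<forall>x\<in>S. nderiv_within S n f differentiable (at x within S))"

definition test_functions :: "(real \<Rightarrow> complex) set" where
  "test_functions = {\<psi>. smooth_within UNIV \<psi> \<and> closure {x. \<psi> x \<noteq> 0} \<subseteq> {0<..<1}}"

section \<open>Sobolev spaces on the unit interval\<close>

text \<open>Elements of function spaces on \<open>[0,1]\<close> are represented by functions on the whole line whose
  values outside \<open>[0,1]\<close> are irrelevant. All the sets of functions below are closed under equality
  almost everywhere on \<open>[0,1]\<close>, so they are unions of equivalence classes.\<close>

abbreviation leb01 :: "real measure" where
  "leb01 \<equiv> lebesgue_on {0..1}"

definition L2_01 :: "(real \<Rightarrow> complex) set" where
  "L2_01 = {u \<in> borel_measurable leb01. integrable leb01 (\<lambda>x. (cmod (u x))\<^sup>2)}"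

definition has_weak_deriv :: "nat \<Rightarrow> (real \<Rightarrow> complex) \<Rightarrow> (real \<Rightarrow> complex) \<Rightarrow> bool" where
  "has_weak_deriv n u g \<longleftrightarrow> integrable leb01 u \<and> integrable leb01 g \<and>
     (\<forall>\<psi>\<in>test_functions.
        (LINT x|leb01. u x * nderiv_within UNIV n \<psi> x) = (-1) ^ n * (LINT x|leb01. g x * \<psi> x))"

definition sobolev :: "nat \<Rightarrow> (real \<Rightarrow> complex) set" where
  "sobolev m = {u \<in> L2_01. \<forall>j\<le>m. \<exists>g\<in>L2_01. has_weak_deriv j u g}"

text \<open>A representative of the weak derivative, which is unique up to a null set if it exists.\<close>
definition weak_deriv :: "nat \<Rightarrow> (real \<Rightarrow> complex) \<Rightarrow> real \<Rightarrow> complex" where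
  "weak_deriv n u = (SOME g. has_weak_deriv n u g)"

text \<open>The pointwise value at \<open>z \<in> [0,1]\<close> of a class that has a continuous representative (as every
  class in \<open>H\<^sup>1\<close> does); that representative is unique on \<open>[0,1]\<close>.\<close>
definition trace_at :: "(real \<Rightarrow> complex) \<Rightarrow> real \<Rightarrow> complex" where
  "trace_at u z = (THE c. \<exists>g. continuous_on {0..1} g \<and> (AE x in leb01. u x = g x) \<and> g z = c)"

definition schroedinger :: "(real \<Rightarrow> real) \<Rightarrow> (real \<Rightarrow> complex) \<Rightarrow> real \<Rightarrow> complex" where
  "schroedinger V u = (\<lambda>x. weak_deriv 2 u x + complex_of_real (V x) * u x)"

text \<open>In \<open>H_V V a\<close> and \<open>H_Dir a\<close> the Sobolev exponent is \<open>2 * a\<close>.\<close>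

definition H_V :: "(real \<Rightarrow> real) \<Rightarrow> nat \<Rightarrow> (real \<Rightarrow> complex) set" where
  "H_V V a = {u \<in> sobolev (2 * a).
     \<forall>l<a. trace_at ((schroedinger V ^^ l) u) 0 = 0 \<and> trace_at ((schroedinger V ^^ l) u) 1 = 0}"

definition H_Dir :: "nat \<Rightarrow> (real \<Rightarrow> complex) set" where
  "H_Dir a = {u \<in> sobolev (2 * a).
     \<forall>l<a. trace_at (weak_deriv (2 * l) u) 0 = 0 \<and> trace_at (weak_deriv (2 * l) u) 1 = 0}"

section \<open>The corrector and its exponential\<close>

text \<open>The interval integral is oriented, so it changes sign when \<open>x < y\<close>.\<close>
fun iter_int :: "nat \<Rightarrow> real \<Rightarrow> (real \<Rightarrow> complex) \<Rightarrow> real \<Rightarrow> complex" where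
  "iter_int 0 y u = u"
| "iter_int (Suc n) y u = (\<lambda>x. LINT z=ereal y..ereal x|lebesgue. iter_int n y u z)"

definition corrector ::
  "(nat \<Rightarrow> nat \<Rightarrow> real \<Rightarrow> real) \<Rightarrow> (nat \<Rightarrow> nat \<Rightarrow> nat \<Rightarrow> real) \<Rightarrow> nat \<Rightarrow> (real \<Rightarrow> complex) \<Rightarrow> real \<Rightarrow> complex" where
  "corrector \<phi> \<alpha> k u = (\<lambda>x. \<Sum>y\<in>{0, 1}. \<Sum>i = 1..k - 1. \<Sum>n = 1..2 * i + 1.
     complex_of_real (\<alpha> i n y) * complex_of_real (\<phi> (2 * i + 1 - n) y x) * iter_int n (real y) u x)"

text \<open>A representative of the sum in \<open>L\<^sup>2([0,1])\<close> of the series of the \<open>T\<^sup>j u / j!\<close>. The \<open>L\<^sup>2\<close>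
  distance is an extended nonnegative integral, so that its convergence to 0 does not hold by
  default for functions that are not square integrable.\<close>
definition op_exp :: "((real \<Rightarrow> complex) \<Rightarrow> real \<Rightarrow> complex) \<Rightarrow> (real \<Rightarrow> complex) \<Rightarrow> real \<Rightarrow> complex" where
  "op_exp T u = (SOME v. v \<in> L2_01 \<and>
     (\<lambda>N. \<integral>\<^sup>+ x. ennreal ((cmod (v x - (\<Sum>j<N. (T ^^ j) u x / fact j)))\<^sup>2) \<partial>leb01) \<longlonglongrightarrow> 0)"

end

theory Submission
  imports Defs "HOL-Computational_Algebra.Polynomial"
begin

text \<open>Both spaces are cut out of \<open>H\<^sup>2\<^sup>k\<^sup>+\<^sup>2\<close> by linear conditions on the jets (the sequences of derivatives) of a
function at the endpoints \<open>y = 0\<close> and \<open>y = 1\<close>, and the corrector acts separately on the two jets.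
The coefficients can therefore be found by algebra in the space of sequences.

\<^bold>\<open>The corrector on jets.\<close> All derivatives of \<open>\<phi>\<close>\<open>\<^sub>p\<^sub>,\<^sub>y\<close> vanish at the endpoint other than \<open>y\<close>, and at
\<open>y\<close> all but the one of order \<open>p\<close>. By Leibniz's rule, the derivative of order \<open>m\<close> of \<open>\<phi>\<close>\<open>\<^sub>p\<^sub>,\<^sub>y\<close> times the
\<open>n\<close>-fold primitive of \<open>u\<close> from \<open>y\<close> is, at \<open>y\<close>, the number \<open>(m choose p)\<close> times the derivative of
\<open>u\<close> of order \<open>m - p - n\<close>. In the corrector \<open>p + n = 2i + 1\<close>, so all terms with the same \<open>i\<close> shift the
jet by the same odd amount and add up to a weight \<open>P\<^sub>i(m)\<close> that is a combination of the
\<open>(m choose j)\<close> with \<open>j \<le> 2i\<close>: any real polynomial of degree at most \<open>2i\<close> occurs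
(\<open>corrector_chain_at\<close>, \<open>polyfun_binomial_basis\<close>).

\<^bold>\<open>The boundary conditions.\<close> Expanding the power, \<open>(\<partial>\<^sup>2 + V)\<^sup>l u(y)\<close> is the sum over \<open>s\<close> of \<open>a\<^sub>s(l)\<close>
times the derivative of order \<open>2l - s\<close>, where \<open>a\<^sub>0 = 1\<close>, \<open>a\<^sub>1 = 0\<close> and \<open>a\<^sub>s\<close> is a polynomial of degree at
most \<open>s - 1\<close> (\<open>schr_coeff_polynomial\<close>). Likewise the exponential of the corrector is a sum of
shifts by \<open>s\<close> with polynomial weights \<open>e\<^sub>s(m)\<close> of degree at most \<open>s - 1\<close>, and \<open>e\<close> at \<open>2i + 1\<close> is \<open>P\<^sub>i\<close>
plus a term made of the \<open>P\<^sub>j\<close> with \<open>j < i\<close>. On a jet without even derivatives only the total shifts by an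
odd \<open>r\<close> contribute, and the conditions hold if the sum over \<open>s \<le> r\<close> of
\<open>a\<^sub>s(l) e\<^sub>r\<^sub>-\<^sub>s(2l - s)\<close> vanishes for all odd \<open>r\<close>. For \<open>r = 2i + 1\<close> this equation can be solved for \<open>P\<^sub>i\<close>,
and the bounds on the degrees say that the solution has degree at most \<open>2i\<close>
(\<open>exists_jet_corrector\<close>). The solution does not depend on \<open>k\<close>: the terms with \<open>i \<ge> k\<close> that the
\<open>k\<close>-th corrector lacks only affect derivatives of order larger than \<open>2k\<close>.

\<^bold>\<open>The analysis.\<close> The fundamental lemma of the calculus of variations and the lemma of du
Bois-Reymond show that a Sobolev function is, up to a null set, the start of a finite chain of functions
each of which is a primitive of the next one (\<open>sobolev_imp_sobolev_rep\<close>); the jets are the endpoint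
values of the chain. The exponential is split as the sum of the terms \<open>C\<^sup>j u / j!\<close> with \<open>j \<le> N\<close> plus
\<open>C\<^sup>N w\<close> with a square integrable function \<open>w\<close> (\<open>op_exp_AE\<close>). Each application of \<open>C\<close> gains a derivative and shifts
the jets by at least 3, so for \<open>N = 2k + 2\<close> the remainder lies in the right Sobolev space and all its
derivatives of order up to \<open>2k\<close> vanish at the endpoints. Thus only the series of values, never the
series of derivatives, has to converge, and on the jets the exponential reduces to a finite sum.\<close>

section \<open>Polynomial functions\<close>

definition polyfun :: "nat \<Rightarrow> (real \<Rightarrow> real) \<Rightarrow> bool" where
  "polyfun d f \<longleftrightarrow> (\<exists>p. degree p \<le> d \<and> (\<forall>x. f x = poly p x))"

lemma polyfun_mono: "polyfun d f \<Longrightarrow> d \<le> e \<Longrightarrow> polyfun e f"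
  unfolding polyfun_def using le_trans by blast

lemma polyfun_const [simp]: "polyfun d (\<lambda>x. c)"
  unfolding polyfun_def by (rule exI[of _ "[:c:]"]) auto

lemma polyfun_add:
  assumes "polyfun d f" "polyfun d g"
  shows "polyfun d (\<lambda>x. f x + g x)"
proof -
  obtain p q where "degree p \<le> d" "\<And>x. f x = poly p x" "degree q \<le> d" "\<And>x. g x = poly q x"
    using assms unfolding polyfun_def by blast
  then show ?thesis unfolding polyfun_def by (intro exI[of _ "p + q"]) (simp add: degree_add_le)
qed

lemma polyfun_mult:
  assumes "polyfun d f" "polyfun e g"
  shows "polyfun (d + e) (\<lambda>x. f x * g x)"
proof -
  obtain p q where "degree p \<le> d" "\<And>x. f x = poly p x" "degree q \<le> e" "\<And>x. g x = poly q x"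
    using assms unfolding polyfun_def by blast
  then show ?thesis unfolding polyfun_def
    using order_trans[OF degree_mult_le[of p q], of "d + e"] by (intro exI[of _ "p * q"]) auto
qed

lemma polyfun_cmult: "polyfun d f \<Longrightarrow> polyfun d (\<lambda>x. c * f x)"
  using polyfun_mult[of 0 "\<lambda>x. c" d f] by simp

lemma polyfun_uminus: "polyfun d f \<Longrightarrow> polyfun d (\<lambda>x. - f x)"
  using polyfun_cmult[of d f "-1"] by simp

lemma polyfun_sum: "(\<And>i. i \<in> I \<Longrightarrow> polyfun d (f i)) \<Longrightarrow> polyfun d (\<lambda>x. \<Sum>i\<in>I. f i x)"
  by (induction I rule: infinite_finite_induct) (auto intro: polyfun_add)

lemma polyfun_affine: "polyfun d f \<Longrightarrow> polyfun d (\<lambda>x. f (a * x + b))"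
proof -
  assume "polyfun d f"
  then obtain p where p: "degree p \<le> d" "\<And>x. f x = poly p x" unfolding polyfun_def by blast
  have "degree (pcompose p [:b, a:]) \<le> d"
    using p(1) degree_pcompose_le[of p "[:b,a:]"] by (cases "a = 0") (auto simp: degree_pcompose)
  moreover have "f (a * x + b) = poly (pcompose p [:b, a:]) x" for x
    by (simp add: p poly_pcompose algebra_simps)
  ultimately show ?thesis unfolding polyfun_def by blast
qed

lemma gchoose_Suc: "(x::real) gchoose Suc j = (x gchoose j) * ((1 / real (Suc j)) * x + (- real j / real (Suc j)))"
proof -
  have "x * (x gchoose j) = real j * (x gchoose j) + real (Suc j) * (x gchoose Suc j)"
    using gbinomial_mult_1[of x j] by simp
  then have "x gchoose Suc j = (x gchoose j) * (x - real j) / real (Suc j)" by (simp add: field_simps)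
  also have "\<dots> = (x gchoose j) * ((1 / real (Suc j)) * x + (- real j / real (Suc j)))"
    by (simp add: right_diff_distrib diff_divide_distrib)
  finally show ?thesis .
qed

lemma gchoose_as_poly:
  "\<exists>p :: real poly. degree p = j \<and> (\<forall>x. x gchoose j = poly p x)"
proof (induction j)
  case 0
  show ?case by (rule exI[of _ 1]) simp
next
  case (Suc j)
  then obtain p :: "real poly" where p: "degree p = j" "\<And>x. x gchoose j = poly p x" by blast
  have "p \<noteq> 0"
  proof
    assume "p = 0"
    then have "real j gchoose j = 0" using p(2) by simp
    then show False by (simp flip: binomial_gbinomial)
  qed
  let ?q = "[:- real j / real (Suc j), 1 / real (Suc j):]"
  have "degree (p * ?q) = Suc j" using \<open>p \<noteq> 0\<close> p(1) by (subst degree_mult_eq) auto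
  moreover have "x gchoose Suc j = poly (p * ?q) x" for x
    unfolding gchoose_Suc p(2) by (simp add: algebra_simps)
  ultimately show ?case by blast
qed

lemma polyfun_gchoose: "polyfun j (\<lambda>x. x gchoose j)"
  unfolding polyfun_def using gchoose_as_poly[of j] by auto

text \<open>The binomial coefficients \<open>x gchoose j\<close> have degree exactly \<open>j\<close>, so the leading term can be removed by
the last one of them. This is used both to sum polynomials and to read off the coefficients of the
corrector.\<close>

lemma polyfun_binomial_basis:
  "polyfun d f \<Longrightarrow> \<exists>c. \<forall>x. f x = (\<Sum>j\<le>d. c j * (x gchoose j))"
proof (induction d arbitrary: f)
  case 0
  then obtain p where "degree p = 0" "\<And>x. f x = poly p x" unfolding polyfun_def by auto
  then obtain a where "\<And>x. f x = a" by (metis degree_eq_zeroE poly_pCons poly_0 add.right_neutral mult_zero_right)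
  then show ?case by (intro exI[of _ "\<lambda>_. a"]) simp
next
  case (Suc d)
  obtain p where p: "degree p \<le> Suc d" "\<And>x. f x = poly p x" using Suc.prems unfolding polyfun_def by blast
  obtain b :: "real poly" where b: "degree b = Suc d" "\<And>x. x gchoose Suc d = poly b x"
    using gchoose_as_poly by blast
  define c where "c = coeff p (Suc d) / coeff b (Suc d)"
  have b0: "coeff b (Suc d) \<noteq> 0" using b(1) by (metis Suc_neq_Zero degree_0 leading_coeff_neq_0)
  have "degree (p - smult c b) \<le> d"
  proof (rule degree_le, intro allI impI)
    fix i assume "d < i"
    show "coeff (p - smult c b) i = 0"
    proof (cases "i = Suc d")
      case True then show ?thesis using b0 by (simp add: c_def)
    next
      case False
      then have "i > Suc d" using \<open>d < i\<close> by simp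
      then show ?thesis using p(1) b(1) by (simp add: coeff_eq_0)
    qed
  qed
  then have "polyfun d (\<lambda>x. poly (p - smult c b) x)" unfolding polyfun_def by blast
  then obtain c' where c': "\<And>x. poly (p - smult c b) x = (\<Sum>j\<le>d. c' j * (x gchoose j))"
    using Suc.IH by blast
  have "f x = (\<Sum>j\<le>Suc d. (c'(Suc d := c)) j * (x gchoose j))" for x
    using c'[of x] b(2)[of x] p(2)[of x] by simp
  then show ?case by blast
qed

text \<open>In the binomial basis summation is the shift of the lower index.\<close>

lemma polyfun_summation:
  assumes "polyfun d f"
  shows "\<exists>F. polyfun (Suc d) F \<and> (\<forall>l::nat. F (real l) = (\<Sum>i<l. f (real i)))"
proof -
  obtain c where c: "\<And>x. f x = (\<Sum>j\<le>d. c j * (x gchoose j))" using polyfun_binomial_basis[OF assms] by blast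
  let ?F = "\<lambda>x::real. \<Sum>j\<le>d. c j * (x gchoose Suc j)"
  have "polyfun (Suc d) ?F"
    by (intro polyfun_sum polyfun_cmult) (auto intro: polyfun_mono[OF polyfun_gchoose])
  moreover have "?F (real l) = (\<Sum>i<l. f (real i))" for l
  proof (induction l)
    case 0 then show ?case by simp
  next
    case (Suc l)
    have "real (Suc l) gchoose Suc j = (real l gchoose j) + (real l gchoose Suc j)" for j
      using gbinomial_Suc_Suc[of "real l" j] by (simp add: add.commute)
    then show ?case using Suc by (simp add: c sum.distrib algebra_simps)
  qed
  ultimately show ?thesis by blast
qed

section \<open>Jets of powers of the Schroedinger operator\<close>

text \<open>The action of \<open>\<partial>\<^sup>2 + V\<close> on the jet \<open>f\<close> of a function, where \<open>v\<close> is the jet of \<open>V\<close>.\<close>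

definition jet_schr :: "(nat \<Rightarrow> real) \<Rightarrow> (nat \<Rightarrow> complex) \<Rightarrow> nat \<Rightarrow> complex" where
  "jet_schr v f j = f (j + 2) + (\<Sum>i\<le>j. of_nat (j choose i) * of_real (v i) * f (j - i))"

text \<open>\<open>schr_coeff v l s\<close> is the factor of the derivative of order \<open>2 * l - s\<close> in the value of
\<open>(\<partial>\<^sup>2 + V)\<^sup>l\<close> at the endpoint. The recursion splits off the innermost operator, so that only the values of
the coefficients, and not their derivatives, enter.\<close>

fun schr_coeff :: "(nat \<Rightarrow> real) \<Rightarrow> nat \<Rightarrow> nat \<Rightarrow> real" where
  "schr_coeff v 0 s = (if s = 0 then 1 else 0)"
| "schr_coeff v (Suc l) r = schr_coeff v l r +
     (\<Sum>s<r - 1. schr_coeff v l s * real ((2 * l - s) choose (r - 2 - s)) * v (r - 2 - s))"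

lemma schr_coeff_eq_0: "2 * l < s \<Longrightarrow> schr_coeff v l s = 0"
proof (induction l arbitrary: s)
  case (Suc l)
  have "schr_coeff v l t * real ((2 * l - t) choose (s - 2 - t)) * v (s - 2 - t) = 0" if "t < s - 1" for t
  proof (cases "2 * l < t")
    case True then show ?thesis using Suc.IH by simp
  next
    case False
    then have "2 * l - t < s - 2 - t" using Suc.prems by simp
    then show ?thesis by (simp add: binomial_eq_0)
  qed
  then have "(\<Sum>t<s - 1. schr_coeff v l t * real ((2 * l - t) choose (s - 2 - t)) * v (s - 2 - t)) = 0"
    by (intro sum.neutral) auto
  then show ?case using Suc by simp
qed simp

lemma jet_schr_power:
  "(jet_schr v ^^ l) f 0 = (\<Sum>s\<le>2 * l. of_real (schr_coeff v l s) * f (2 * l - s))"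
proof (induction l arbitrary: f)
  case 0 then show ?case by simp
next
  case (Suc l)
  define g where "g s i = of_real (schr_coeff v l s) * (of_nat ((2 * l - s) choose i) * of_real (v i) * f (2 * l - s - i))" for s i
  have "(jet_schr v ^^ Suc l) f 0 = (jet_schr v ^^ l) (jet_schr v f) 0"
    by (simp add: funpow_swap1)
  also have "\<dots> = (\<Sum>s\<le>2 * l. of_real (schr_coeff v l s) * f (2 * l - s + 2)) + (\<Sum>s\<le>2*l. \<Sum>i\<le>2*l-s. g s i)"
    unfolding Suc.IH jet_schr_def g_def by (simp add: algebra_simps sum.distrib sum_distrib_left)
  also have "(\<Sum>s\<le>2 * l. of_real (schr_coeff v l s) * f (2 * l - s + 2)) =
      (\<Sum>s\<le>2 * Suc l. of_real (schr_coeff v l s) * f (2 * Suc l - s))"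
  proof (rule sum.mono_neutral_cong_left)
    show "\<forall>i\<in>{..2 * Suc l} - {..2 * l}. complex_of_real (schr_coeff v l i) * f (2 * Suc l - i) = 0"
      by (simp add: schr_coeff_eq_0)
  qed (auto simp: Suc_diff_le)
  also have "(\<Sum>s\<le>2*l. \<Sum>i\<le>2*l-s. g s i) = (\<Sum>r\<le>2 * Suc l. \<Sum>s<r-1. g s (r - 2 - s))"
    unfolding sum.Sigma[OF finite_atMost ballI[OF finite_atMost]] sum.Sigma[OF finite_atMost ballI[OF finite_lessThan]]
    by (rule sum.reindex_bij_witness[of _ "\<lambda>(r,s). (s, r - 2 - s)" "\<lambda>(s,i). (s + i + 2, s)"]) auto
  also have "(\<Sum>s\<le>2 * Suc l. of_real (schr_coeff v l s) * f (2 * Suc l - s)) + \<dots> =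
      (\<Sum>s\<le>2 * Suc l. of_real (schr_coeff v (Suc l) s) * f (2 * Suc l - s))"
    unfolding sum.distrib[symmetric]
  proof (rule sum.cong[OF refl])
    fix r assume "r \<in> {..2 * Suc l}"
    have "g s (r - 2 - s) = of_real (schr_coeff v l s * real ((2 * l - s) choose (r - 2 - s)) * v (r - 2 - s)) * f (2 * Suc l - r)"
      if "s < r - 1" for s
    proof -
      have "2 * l - s - (r - 2 - s) = 2 * Suc l - r" using that by simp
      then show ?thesis unfolding g_def by simp
    qed
    then have "(\<Sum>s<r-1. g s (r - 2 - s)) = (\<Sum>s<r-1. of_real (schr_coeff v l s * real ((2 * l - s) choose (r - 2 - s)) * v (r - 2 - s)) * f (2 * Suc l - r))"
      by (intro sum.cong) auto
    then show "of_real (schr_coeff v l r) * f (2 * Suc l - r) + (\<Sum>s<r-1. g s (r - 2 - s)) =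
      of_real (schr_coeff v (Suc l) r) * f (2 * Suc l - r)"
      by (simp add: sum_distrib_right distrib_right)
  qed
  finally show ?case .
qed

text \<open>The increment of the coefficient in \<open>l\<close> is a combination of earlier coefficients times polynomials
\<open>(2l - t) gchoose (s - 2 - t)\<close> of degree \<open>s - 2 - t\<close>, hence of degree at most \<open>s - 2\<close>; summation raises the degree
by one.\<close>

lemma schr_coeff_polynomial:
  "\<exists>A. polyfun (s - 1) A \<and> (\<forall>l. schr_coeff v l s = A (real l))"
proof (induction s rule: less_induct)
  case (less s)
  have "\<exists>A. \<forall>t<s. polyfun (t - 1) (A t) \<and> (\<forall>l. schr_coeff v l t = A t (real l))"
    using less by metis
  then obtain A where A: "\<And>t. t < s \<Longrightarrow> polyfun (t - 1) (A t)" "\<And>t l. t < s \<Longrightarrow> schr_coeff v l t = A t (real l)"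
    by blast
  define g where "g = (\<lambda>x. \<Sum>t<s-1. v (s - 2 - t) * (A t x * ((2 * x + (- real t)) gchoose (s - 2 - t))))"
  have step: "schr_coeff v (Suc l) s = schr_coeff v l s + g (real l)" for l
  proof -
    have "schr_coeff v l t * real ((2 * l - t) choose (s - 2 - t)) * v (s - 2 - t) =
      v (s - 2 - t) * (A t (real l) * ((2 * real l + (- real t)) gchoose (s - 2 - t)))" if "t < s - 1" for t
    \<comment> \<open>For \<open>2l < t\<close> the natural and the real binomial coefficient differ, but there the factor in front is 0.\<close>
    proof (cases "t \<le> 2 * l")
      case True
      then have *: "2 * real l + (- real t) = real (2 * l - t)" by (simp add: of_nat_diff)
      have "t < s" using that by simp
      then show ?thesis unfolding * binomial_gbinomial[symmetric] by (simp only: A(2)[symmetric] mult_ac)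
    next
      case False
      then have "schr_coeff v l t = 0" by (simp add: schr_coeff_eq_0)
      moreover from this have "A t (real l) = 0" using A(2)[of t l] that by linarith
      ultimately show ?thesis by simp
    qed
    then have "(\<Sum>t<s-1. schr_coeff v l t * real ((2 * l - t) choose (s - 2 - t)) * v (s - 2 - t)) = g (real l)"
      unfolding g_def by (intro sum.cong) auto
    then show ?thesis by simp
  qed
  have eq: "schr_coeff v l s = (if s = 0 then 1 else 0) + (\<Sum>i<l. g (real i))" for l
  proof (induction l)
    case (Suc l)
    then show ?case unfolding step by simp
  qed simp
  show ?case
  proof (cases "s \<le> 1")
    case True
    then have "g x = 0" for x by (simp add: g_def)
    then show ?thesis using eq by (intro exI[of _ "\<lambda>_. if s = 0 then 1 else 0"]) simp
  next
    case False
    have "polyfun (s - 2) g" unfolding g_def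
    proof (intro polyfun_sum polyfun_cmult)
      fix t assume t: "t \<in> {..<s - 1}"
      have "polyfun ((t - 1) + (s - 2 - t)) (\<lambda>x. A t x * ((2 * x + (- real t)) gchoose (s - 2 - t)))"
        using t by (intro polyfun_mult polyfun_affine[OF polyfun_gchoose] A) auto
      then show "polyfun (s - 2) (\<lambda>x. A t x * ((2 * x + (- real t)) gchoose (s - 2 - t)))"
        by (rule polyfun_mono) (use t in auto)
    qed
    then obtain G where G: "polyfun (Suc (s - 2)) G" "\<And>l. G (real l) = (\<Sum>i<l. g (real i))"
      using polyfun_summation by blast
    have "Suc (s - 2) = s - 1" using False by simp
    then have "polyfun (s - 1) G" using G(1) by simp
    then show ?thesis using eq G(2) False by (intro exI[of _ G]) auto
  qed
qed

section \<open>Jets of the exponential of the corrector\<close>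

text \<open>The action on jets of a sum of shifts by the odd numbers \<open>2 * i + 1 \<ge> 3\<close> with weights \<open>P i\<close>; orders that
would become negative contribute nothing, because primitives vanish at their base point.\<close>

definition jet_corr :: "(nat \<Rightarrow> real \<Rightarrow> real) \<Rightarrow> (nat \<Rightarrow> complex) \<Rightarrow> nat \<Rightarrow> complex" where
  "jet_corr P f m = (\<Sum>i | 1 \<le> i \<and> 2 * i + 1 \<le> m. of_real (P i (real m)) * f (m - (2 * i + 1)))"

lemma jet_corr_cong: "(\<And>i. i \<le> j \<Longrightarrow> f i = g i) \<Longrightarrow> jet_corr P f j = jet_corr P g j"
  unfolding jet_corr_def by (intro sum.cong refl) simp

text \<open>The weight of the shift by \<open>s\<close> in the \<open>j\<close>-th power. The argument is the order of the derivative; it is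
taken in the reals, so that the weights can be treated as polynomials.\<close>

fun pow_coeff :: "(nat \<Rightarrow> real \<Rightarrow> real) \<Rightarrow> nat \<Rightarrow> nat \<Rightarrow> real \<Rightarrow> real" where
  "pow_coeff P 0 s x = (if s = 0 then 1 else 0)"
| "pow_coeff P (Suc j) s x =
     (\<Sum>i | 1 \<le> i \<and> 2 * i + 1 \<le> s. P i x * pow_coeff P j (s - (2 * i + 1)) (x - real (2 * i + 1)))"

lemma finite_odd_shifts [simp]: "finite {i. Suc 0 \<le> i \<and> Suc (2 * i) \<le> (m::nat)}"
  by (rule finite_subset[of _ "{..m}"]) auto

lemma jet_corr_power:
  "(jet_corr P ^^ j) f m = (\<Sum>s\<le>m. of_real (pow_coeff P j s (real m)) * f (m - s))"
proof (induction j arbitrary: m)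
  case 0
  have "(\<Sum>s\<le>m. of_real (pow_coeff P 0 s (real m)) * f (m - s)) = (\<Sum>s\<in>{0}. f (m - s))"
    by (rule sum.mono_neutral_cong_right) auto
  then show ?case by simp
next
  case (Suc j)
  let ?I = "\<lambda>m::nat. {i::nat. 1 \<le> i \<and> 2 * i + 1 \<le> m}"
  have fin: "finite (?I m)" for m by simp
  have "(jet_corr P ^^ Suc j) f m = (\<Sum>i\<in>?I m. \<Sum>t\<le>m-(2*i+1).
      of_real (P i (real m) * pow_coeff P j t (real m - real (2*i+1))) * f (m - (2*i+1) - t))"
    unfolding funpow.simps comp_apply jet_corr_def[of P "(jet_corr P ^^ j) f"] Suc.IH sum_distrib_left
    by (intro sum.cong) (auto simp: of_nat_diff)
  also have "\<dots> = (\<Sum>s\<le>m. \<Sum>i\<in>?I s.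
      of_real (P i (real m) * pow_coeff P j (s - (2*i+1)) (real m - real (2*i+1))) * f (m - s))"
    unfolding sum.Sigma[OF fin ballI[OF finite_atMost]] sum.Sigma[OF finite_atMost ballI[OF fin]]
    by (rule sum.reindex_bij_witness[of _ "\<lambda>(s,i). (i, s - (2*i+1))" "\<lambda>(i,t). (t + (2*i+1), i)"]) (auto simp: add.commute)
  also have "\<dots> = (\<Sum>s\<le>m. of_real (pow_coeff P (Suc j) s (real m)) * f (m - s))"
    by (simp add: sum_distrib_right)
  finally show ?case .
qed

lemma pow_coeff_eq_0: "s < j \<Longrightarrow> pow_coeff P j s x = 0"
  by (induction j arbitrary: s x) (auto intro!: sum.neutral)

text \<open>Each factor shifts by one more than the degree of its weight, so \<open>j\<close> factors leave a gap of \<open>j\<close> between the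
shift and the degree.\<close>

lemma polyfun_pow_coeff:
  assumes P: "\<And>i. polyfun (2 * i) (P i)"
  shows "polyfun (s - j) (pow_coeff P j s)"
proof (induction j arbitrary: s)
  case 0 then show ?case by simp
next
  case (Suc j)
  have "polyfun (s - Suc j) (\<lambda>x. P i x * pow_coeff P j (s - (2 * i + 1)) (x - real (2 * i + 1)))"
    if i: "1 \<le> i" "2 * i + 1 \<le> s" for i
  proof (cases "s - (2 * i + 1) < j")
    case True
    then have "(\<lambda>x. P i x * pow_coeff P j (s - (2 * i + 1)) (x - real (2 * i + 1))) = (\<lambda>x. 0)"
      by (simp add: pow_coeff_eq_0)
    then show ?thesis using polyfun_const by metis
  next
    case False
    have "polyfun (2 * i + (s - (2 * i + 1) - j)) (\<lambda>x. P i x * pow_coeff P j (s - (2 * i + 1)) (x - real (2 * i + 1)))"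
      using polyfun_mult[OF P[of i] polyfun_affine[OF Suc.IH[of "s - (2*i+1)"], of 1 "- real (2 * i + 1)"]]
      by (simp only: mult_1 add_uminus_conv_diff)
    then show ?thesis by (rule polyfun_mono) (use False i in auto)
  qed
  then show ?case by (simp only: pow_coeff.simps, intro polyfun_sum) auto
qed

lemma pow_coeff_cong:
  "(\<And>i. 1 \<le> i \<Longrightarrow> 2 * i + 1 \<le> s \<Longrightarrow> P i = Q i) \<Longrightarrow> pow_coeff P j s x = pow_coeff Q j s x"
  by (induction j arbitrary: s x) (auto intro!: sum.cong)

definition exp_coeff :: "(nat \<Rightarrow> real \<Rightarrow> real) \<Rightarrow> nat \<Rightarrow> real \<Rightarrow> real" where
  "exp_coeff P s x = (\<Sum>j\<le>s. pow_coeff P j s x / fact j)"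

text \<open>A power with more factors than the order of the derivative vanishes, so any sufficiently long partial
sum of the exponential series gives its full action.\<close>

lemma jet_corr_exp:
  assumes "m < N"
  shows "(\<Sum>j<N. (jet_corr P ^^ j) f m / fact j) = (\<Sum>s\<le>m. of_real (exp_coeff P s (real m)) * f (m - s))"
proof -
  have *: "(\<Sum>j<N. pow_coeff P j s x / fact j) = exp_coeff P s x" if "s \<le> m" for s x
    unfolding exp_coeff_def using that assms
    by (intro sum.mono_neutral_right) (auto simp: pow_coeff_eq_0)
  have "(\<Sum>j<N. (jet_corr P ^^ j) f m / fact j) =
      (\<Sum>s\<le>m. \<Sum>j<N. of_real (pow_coeff P j s (real m) / fact j) * f (m - s))"
    unfolding jet_corr_power sum_divide_distrib
    by (subst sum.swap) (simp add: field_simps)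
  also have "\<dots> = (\<Sum>s\<le>m. of_real (exp_coeff P s (real m)) * f (m - s))"
    unfolding sum_distrib_right[symmetric] of_real_sum[symmetric]
    by (intro sum.cong refl) (simp only: * atMost_iff)
  finally show ?thesis .
qed

lemma exp_coeff_0 [simp]: "exp_coeff P 0 x = 1" by (simp add: exp_coeff_def)

lemma polyfun_exp_coeff:
  assumes P: "\<And>i. polyfun (2 * i) (P i)"
  shows "polyfun (s - 1) (exp_coeff P s)"
proof -
  have "polyfun (s - 1) (\<lambda>x. (1 / fact j) * pow_coeff P j s x)" for j
  proof (cases "j = 0")
    case True then show ?thesis by simp
  next
    case False
    then have "polyfun (s - 1) (pow_coeff P j s)" by (intro polyfun_mono[OF polyfun_pow_coeff[OF P]]) auto
    then show ?thesis by (rule polyfun_cmult)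
  qed
  then show ?thesis unfolding exp_coeff_def by (intro polyfun_sum) simp
qed

lemma exp_coeff_cong:
  "(\<And>i. 1 \<le> i \<Longrightarrow> 2 * i + 1 \<le> s \<Longrightarrow> P i = Q i) \<Longrightarrow> exp_coeff P s x = exp_coeff Q s x"
  unfolding exp_coeff_def by (intro sum.cong refl) (simp cong: pow_coeff_cong)

text \<open>A shift by \<open>2 * i + 1\<close> uses the weight \<open>P i\<close> only in the linear term of the exponential, since a product of
several shifts that contains the one by \<open>2 * i + 1\<close> is longer.\<close>

lemma exp_coeff_top:
  assumes i: "1 \<le> i"
  shows "exp_coeff P (2 * i + 1) x = P i x + exp_coeff (P(i := \<lambda>_. 0)) (2 * i + 1) x"
proof -
  let ?Q = "P(i := \<lambda>_. 0)"
  have diff: "pow_coeff P j (2*i+1) x = pow_coeff ?Q j (2*i+1) x + (if j = 1 then P i x else 0)" for j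
  proof (cases j)
    case 0 then show ?thesis by simp
  next
    case (Suc j')
    have "P k x * pow_coeff P j' (2*i+1 - (2 * k + 1)) (x - real (2 * k + 1)) =
      ?Q k x * pow_coeff ?Q j' (2*i+1 - (2 * k + 1)) (x - real (2 * k + 1))
        + (if k = i then (if j = 1 then P i x else 0) else 0)"
      if "1 \<le> k" "2 * k + 1 \<le> 2 * i + 1" for k
    proof (cases "k = i")
      case True
      have "pow_coeff P j' 0 y = (if j = 1 then 1 else 0)" for y
        using Suc by (cases j') auto
      then show ?thesis using True by simp
    next
      case False
      have "pow_coeff P j' (2*i+1 - (2 * k + 1)) y = pow_coeff ?Q j' (2*i+1 - (2 * k + 1)) y" for y
        by (rule pow_coeff_cong) (use that in auto)
      then show ?thesis using False by simp
    qed
    then have "pow_coeff P j (2*i+1) x = (\<Sum>k | 1 \<le> k \<and> 2 * k + 1 \<le> 2 * i + 1.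
      ?Q k x * pow_coeff ?Q j' (2*i+1 - (2 * k + 1)) (x - real (2 * k + 1))
        + (if k = i then (if j = 1 then P i x else 0) else 0))"
      unfolding Suc pow_coeff.simps using Suc by (intro sum.cong refl) auto
    then show ?thesis using i Suc by (simp add: sum.distrib)
  qed
  have "exp_coeff P (2*i+1) x = exp_coeff ?Q (2*i+1) x + (\<Sum>j\<le>2*i+1. (if j = 1 then P i x else 0) / fact j)"
    unfolding exp_coeff_def sum.distrib[symmetric] diff add_divide_distrib ..
  also have "(\<Sum>j\<le>2*i+1. (if j = 1 then P i x else 0) / fact j) = (\<Sum>j\<in>{1::nat}. P i x)"
    by (rule sum.mono_neutral_cong_right[OF finite_atMost]) auto
  finally show ?thesis by (simp add: fun_upd_def)
qed

text \<open>The requirement that the coefficient of every odd total shift \<open>2 * i + 1\<close> vanishes is an equation of the form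
\<open>P i = \<dots>\<close> whose right-hand side involves the earlier weights only. It determines \<open>P\<close> by well-founded
recursion, and adding up the degrees of the factors keeps \<open>P i\<close> within degree \<open>2 * i\<close>.\<close>

lemma exists_jet_corrector:
  fixes v :: "nat \<Rightarrow> real"
  obtains P where "\<And>i. polyfun (2 * i) (P i)"
    "\<And>l N f. \<lbrakk>2 * l < N; \<And>l'. l' \<le> l \<Longrightarrow> f (2 * l') = 0\<rbrakk> \<Longrightarrow>
       (jet_schr v ^^ l) (\<lambda>m. \<Sum>j<N. (jet_corr P ^^ j) f m / fact j) 0 = 0"
proof -
  obtain A where A: "\<And>s. polyfun (s - 1) (A s)" "\<And>s l. schr_coeff v l s = A s (real l)"
    using schr_coeff_polynomial[of _ v] by metis
  \<comment> \<open>The boundary conditions concern the orders \<open>x = 2l\<close>, hence the argument \<open>x / 2\<close> of \<open>A\<close>. Setting \<open>P i\<close> to 0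
removes the unknown from the right-hand side, as \<open>exp_coeff_top\<close> describes.\<close>
  define \<Phi> where "\<Phi> P i = (\<lambda>x. - (\<Sum>s\<le>2*i+1. A s (x / 2) * exp_coeff (P(i := \<lambda>_. 0)) (2*i+1-s) (x - real s)))"
    for P :: "nat \<Rightarrow> real \<Rightarrow> real" and i
  define P where "P = wfrec less_than \<Phi>"
  have "adm_wf less_than \<Phi>"
    unfolding adm_wf_def
  proof (intro allI impI)
    fix f g :: "nat \<Rightarrow> real \<Rightarrow> real" and i
    assume fg: "\<forall>z. (z, i) \<in> less_than \<longrightarrow> f z = g z"
    have "exp_coeff (f(i := \<lambda>_. 0)) (2*i+1-s) y = exp_coeff (g(i := \<lambda>_. 0)) (2*i+1-s) y" for s y
      by (rule exp_coeff_cong) (use fg in auto)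
    then show "\<Phi> f i = \<Phi> g i" unfolding \<Phi>_def by simp
  qed
  then have fix_P: "P i = \<Phi> P i" for i
    unfolding P_def using wfrec_fixpoint[of less_than \<Phi>] by simp
  have poly: "polyfun (2 * i) (P i)" for i
  proof (induction i rule: less_induct)
    case (less i)
    define Q where "Q = (\<lambda>k. if k < i then P k else (\<lambda>_. 0))"
    have Q: "polyfun (2 * k) (Q k)" for k using less by (simp add: Q_def)
    have eq: "exp_coeff (P(i := \<lambda>_. 0)) (2*i+1-s) y = exp_coeff Q (2*i+1-s) y" for s y
      by (rule exp_coeff_cong) (auto simp: Q_def)
    have "polyfun (2 * i) (\<lambda>x. A s (x / 2) * exp_coeff Q (2*i+1-s) (x - real s))" if "s \<le> 2*i+1" for s
    proof -
      have "polyfun (s - 1 + (2*i+1-s-1)) (\<lambda>x. A s (x / 2) * exp_coeff Q (2*i+1-s) (x - real s))"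
        using polyfun_mult[OF polyfun_affine[OF A(1)[of s], of "1/2" 0]
            polyfun_affine[OF polyfun_exp_coeff[OF Q, of "2*i+1-s"], of 1 "- real s"]] by simp
      then show ?thesis by (rule polyfun_mono) (use that in auto)
    qed
    then show ?case unfolding fix_P[of i] \<Phi>_def eq by (intro polyfun_uminus polyfun_sum) auto
  qed
  have cancel: "(\<Sum>s\<le>2*i+1. A s (x / 2) * exp_coeff P (2*i+1-s) (x - real s)) = 0" if "1 \<le> i" for i x
  proof -
    have A0: "A 0 y = 1" for y
    proof -
      have "\<exists>c. \<forall>x. A 0 x = c" using polyfun_binomial_basis[OF A(1)[of 0]] by auto
      moreover have "A 0 0 = 1" using A(2)[of 0 0] by simp
      ultimately show ?thesis by metis
    qed
    have "A s (x / 2) * exp_coeff P (2*i+1-s) (x - real s) =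
      A s (x / 2) * exp_coeff (P(i := \<lambda>_. 0)) (2*i+1-s) (x - real s) + (if s = 0 then P i x else 0)"
      if "s \<le> 2 * i + 1" for s
    proof (cases "s = 0")
      case True then show ?thesis using exp_coeff_top[OF \<open>1 \<le> i\<close>, of P x] by (simp add: A0)
    next
      case False
      then have "exp_coeff P (2*i+1-s) (x - real s) = exp_coeff (P(i := \<lambda>_. 0)) (2*i+1-s) (x - real s)"
        by (intro exp_coeff_cong) auto
      then show ?thesis using False by simp
    qed
    then have "(\<Sum>s\<le>2*i+1. A s (x / 2) * exp_coeff P (2*i+1-s) (x - real s)) =
      (\<Sum>s\<le>2*i+1. A s (x / 2) * exp_coeff (P(i := \<lambda>_. 0)) (2*i+1-s) (x - real s)) + (\<Sum>s\<le>2*i+1. if s = 0 then P i x else 0)"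
      unfolding sum.distrib[symmetric] by (intro sum.cong) auto
    then show ?thesis using fix_P[of i] by (simp add: \<Phi>_def)
  qed
  show thesis
  proof (rule that[of P, OF poly])
    fix l N :: nat and f :: "nat \<Rightarrow> complex"
    assume N: "2 * l < N" and f: "\<And>l'. l' \<le> l \<Longrightarrow> f (2 * l') = 0"
    let ?g = "\<lambda>s t. of_real (A s (real l) * exp_coeff P t (real (2 * l) - real s)) * f (2 * l - s - t)"
    have "(jet_schr v ^^ l) (\<lambda>m. \<Sum>j<N. (jet_corr P ^^ j) f m / fact j) 0 =
      (\<Sum>s\<le>2*l. \<Sum>t\<le>2*l-s. ?g s t)"
      unfolding jet_schr_power A(2) 
      by (intro sum.cong refl) (use N in \<open>simp add: jet_corr_exp sum_distrib_left of_nat_diff mult.assoc\<close>)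
    also have "\<dots> = (\<Sum>r\<le>2*l. \<Sum>s\<le>r. ?g s (r - s))"
      unfolding sum.Sigma[OF finite_atMost ballI[OF finite_atMost]]
      by (rule sum.reindex_bij_witness[of _ "\<lambda>(r,s). (s, r - s)" "\<lambda>(s,t). (s + t, s)"]) auto
    also have "\<dots> = 0"
    proof (rule sum.neutral, rule ballI)
      fix r assume r: "r \<in> {..2*l}"
      have *: "(\<Sum>s\<le>r. ?g s (r - s)) =
         of_real (\<Sum>s\<le>r. A s (real l) * exp_coeff P (r - s) (real (2 * l) - real s)) * f (2 * l - r)"
        unfolding of_real_sum sum_distrib_right by (intro sum.cong) auto
      show "(\<Sum>s\<le>r. ?g s (r - s)) = 0"
      \<comment> \<open>An even shift meets the even derivatives of \<open>f\<close>, which vanish; for an odd shift the coefficient vanishes.\<close>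
      proof (cases "even r")
        case True
        then obtain r' where "r = 2 * r'" by blast
        then have "f (2 * l - r) = 0" using f[of "l - r'"] r by (simp add: diff_mult_distrib2)
        then show ?thesis unfolding * by simp
      next
        case False
        then obtain i where i: "r = 2 * i + 1" by (elim oddE)
        have "(\<Sum>s\<le>r. A s (real l) * exp_coeff P (r - s) (real (2 * l) - real s)) = 0"
        \<comment> \<open>There is no shift by 1 on either side, so nothing has to be corrected.\<close>
        proof (cases "i = 0")
          case True
          have "A 1 (real l) = 0" 
          proof -
            have "schr_coeff v l 1 = 0" by (induction l) auto
            then show ?thesis by (simp add: A(2))
          qed
          moreover have "exp_coeff P 1 x = 0" for x
          proof -
            have "pow_coeff P 1 1 x = 0" unfolding One_nat_def pow_coeff.simps by (rule sum.neutral) auto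
            then show ?thesis unfolding exp_coeff_def by simp
          qed
          ultimately show ?thesis using i True by simp
        next
          case False
          then show ?thesis using cancel[of i "real (2 * l)"] i by simp
        qed
        then show ?thesis unfolding * by simp
      qed
    qed
    finally show "(jet_schr v ^^ l) (\<lambda>m. \<Sum>j<N. (jet_corr P ^^ j) f m / fact j) 0 = 0" .
  qed
qed

section \<open>Square integrable functions and primitives\<close>

lemma finite_measure_lebesgue_Icc: "finite_measure (lebesgue_on {a..b::real})"
  by (rule finite_measure_lebesgue_on) simp

lemma integrable_leb01_sub:
  "integrable leb01 f \<Longrightarrow> x \<in> {0..1} \<Longrightarrow> integrable (lebesgue_on {0..x}) (f :: real \<Rightarrow> complex)"
  by (rule integrable_subinterval) auto

lemma integrable_leb01_on:
  "integrable leb01 (f :: real \<Rightarrow> complex) \<Longrightarrow> x \<in> {0..1} \<Longrightarrow> f integrable_on {0..x}"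
  by (rule integrable_on_lebesgue_on[OF integrable_leb01_sub]) auto

lemma integral_leb01_sub:
  "integrable leb01 (f :: real \<Rightarrow> complex) \<Longrightarrow> x \<in> {0..1} \<Longrightarrow>
     integral\<^sup>L (lebesgue_on {0..x}) f = integral {0..x} f"
  by (rule lebesgue_integral_eq_integral[OF integrable_leb01_sub]) auto

lemma borel_measurable_leb_AE:
  fixes f g :: "real \<Rightarrow> complex"
  assumes f: "f \<in> borel_measurable leb01" and ae: "AE x in leb01. f x = g x"
  shows "g \<in> borel_measurable leb01"
proof -
  have "(\<lambda>x. indicator {0..1} x *\<^sub>R f x) \<in> borel_measurable lebesgue"
    using f by (simp add: borel_measurable_restrict_space_iff)
  moreover have "AE x in lebesgue. indicator {0..1} x *\<^sub>R f x = indicator {0..1} x *\<^sub>R g x"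
    using ae by (subst (asm) AE_restrict_space_iff) (auto elim!: eventually_mono split: split_indicator)
  ultimately have "(\<lambda>x. indicator {0..1} x *\<^sub>R g x) \<in> borel_measurable lebesgue"
    by (rule borel_measurable_AE)
  then show ?thesis by (simp add: borel_measurable_restrict_space_iff)
qed

lemma integrable_leb_AE:
  fixes f g :: "real \<Rightarrow> complex"
  assumes "integrable leb01 f" "AE x in leb01. f x = g x"
  shows "integrable leb01 g"
  by (rule integrable_cong_AE_imp[OF assms(1) borel_measurable_leb_AE[OF borel_measurable_integrable[OF assms(1)] assms(2)] assms(2)])

lemma integral_sub_cong_AE:
  fixes f g :: "real \<Rightarrow> complex"
  assumes f: "integrable leb01 f" and ae: "AE x in leb01. f x = g x" and x: "x \<in> {0..1}"
  shows "integral {0..x} f = integral {0..x} g"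
proof -
  have g: "integrable leb01 g" by (rule integrable_leb_AE[OF f ae])
  have "AE t in lebesgue_on {0..x}. f t = g t"
    using ae x by (auto simp: AE_restrict_space_iff elim!: eventually_mono)
  then have "integral\<^sup>L (lebesgue_on {0..x}) f = integral\<^sup>L (lebesgue_on {0..x}) g"
    using integrable_leb01_sub[OF f x] integrable_leb01_sub[OF g x] by (intro integral_cong_AE) auto
  then show ?thesis unfolding integral_leb01_sub[OF f x] integral_leb01_sub[OF g x] .
qed

lemma continuous_leb01_measurable:
  "continuous_on {0..1} (f :: real \<Rightarrow> complex) \<Longrightarrow> f \<in> borel_measurable leb01"
  by (rule continuous_imp_measurable_on_sets_lebesgue) auto

lemma continuous_integrable_leb01:
  fixes f :: "real \<Rightarrow> complex"
  assumes "continuous_on {0..1} f" shows "integrable leb01 f"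
  by (rule absolutely_integrable_imp_integrable[OF absolutely_integrable_continuous_real[OF assms]]) auto

lemma integrable_leb01_bounded:
  fixes f :: "real \<Rightarrow> complex"
  assumes "f \<in> borel_measurable leb01" "\<And>x. x \<in> {0..1} \<Longrightarrow> norm (f x) \<le> B"
  shows "integrable leb01 f"
proof -
  interpret finite_measure leb01 by (rule finite_measure_lebesgue_Icc)
  show ?thesis by (rule integrable_const_bound[of _ B]) (use assms in auto)
qed

lemma integrable_leb01_mult_bounded:
  fixes f g :: "real \<Rightarrow> complex"
  assumes f: "integrable leb01 f" and g: "g \<in> borel_measurable leb01" "\<And>x. x \<in> {0..1} \<Longrightarrow> norm (g x) \<le> B"
  shows "integrable leb01 (\<lambda>x. g x * f x)"
proof (rule Bochner_Integration.integrable_bound)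
  show "integrable leb01 (\<lambda>x. B * norm (f x))" using f by simp
  have "norm (g x * f x) \<le> norm (B * norm (f x))" if "x \<in> {0..1}" for x
    using g(2)[OF that] by (smt (verit) mult_right_mono norm_ge_zero norm_mult real_norm_def abs_ge_self)
  then show "AE x in leb01. norm (g x * f x) \<le> norm (B * norm (f x))" by auto
qed (use f g in measurable)

lemma continuous_on_unit_bound:
  fixes g :: "real \<Rightarrow> complex"
  assumes "continuous_on {0..1} g"
  obtains B where "B > 0" "\<And>x. x \<in> {0..1} \<Longrightarrow> norm (g x) \<le> B"
proof -
  have "bounded (g ` {0..1})" by (intro compact_imp_bounded compact_continuous_image assms compact_Icc)
  then obtain B where "B > 0" "\<forall>y\<in>g ` {0..1}. norm y \<le> B" unfolding bounded_pos by blast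
  then show thesis by (intro that[of B]) auto
qed

lemma integrable_leb01_mult_continuous:
  fixes f g :: "real \<Rightarrow> complex"
  assumes f: "integrable leb01 f" and g: "continuous_on {0..1} g"
  shows "integrable leb01 (\<lambda>x. g x * f x)"
proof -
  obtain B where "\<And>x. x \<in> {0..1} \<Longrightarrow> norm (g x) \<le> B" using continuous_on_unit_bound[OF g] by blast
  then show ?thesis by (rule integrable_leb01_mult_bounded[OF f continuous_leb01_measurable[OF g]])
qed

lemma L2_AE: 
  assumes f: "f \<in> L2_01" and ae: "AE x in leb01. f x = g x" shows "g \<in> L2_01"
proof -
  have m: "g \<in> borel_measurable leb01" using f borel_measurable_leb_AE[OF _ ae] unfolding L2_01_def by auto
  have "integrable leb01 (\<lambda>x. (cmod (g x))\<^sup>2)"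
    by (rule integrable_cong_AE_imp[of _ "\<lambda>x. (cmod (f x))\<^sup>2"]) (use f m ae in \<open>auto simp: L2_01_def elim!: eventually_mono\<close>)
  then show ?thesis using m unfolding L2_01_def by auto
qed

lemma L2_cong: "f \<in> L2_01 \<Longrightarrow> (\<And>x. x \<in> {0..1} \<Longrightarrow> f x = g x) \<Longrightarrow> g \<in> L2_01"
  by (rule L2_AE) (auto intro: AE_I2)

lemma L2_integrable:
  assumes "f \<in> L2_01" shows "integrable leb01 f"
proof (rule Bochner_Integration.integrable_bound)
  interpret finite_measure leb01 by (rule finite_measure_lebesgue_Icc)
  show "integrable leb01 (\<lambda>x. 1 + (cmod (f x))\<^sup>2)" using assms unfolding L2_01_def by auto
  have "c \<le> 1 + c\<^sup>2" for c :: real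
    using zero_le_power2[of "c - 1"] zero_le_power2[of c] unfolding power2_diff power_one by linarith
  then show "AE x in leb01. norm (f x) \<le> norm (1 + (cmod (f x))\<^sup>2)" by simp
qed (use assms in \<open>auto simp: L2_01_def\<close>)

lemma L2_add:
  assumes f: "f \<in> L2_01" and g: "g \<in> L2_01" shows "(\<lambda>x. f x + g x) \<in> L2_01"
proof -
  have [measurable]: "f \<in> borel_measurable leb01" "g \<in> borel_measurable leb01" using f g unfolding L2_01_def by auto
  have "integrable leb01 (\<lambda>x. (cmod (f x + g x))\<^sup>2)"
  proof (rule Bochner_Integration.integrable_bound)
    show "integrable leb01 (\<lambda>x. 2 * (cmod (f x))\<^sup>2 + 2 * (cmod (g x))\<^sup>2)" using f g unfolding L2_01_def by auto
    have "(cmod (a + b))\<^sup>2 \<le> 2 * (cmod a)\<^sup>2 + 2 * (cmod b)\<^sup>2" for a b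
    proof -
      have "(cmod (a + b))\<^sup>2 \<le> (cmod a + cmod b)\<^sup>2" by (rule power_mono[OF norm_triangle_ineq]) simp
      also have "\<dots> \<le> 2 * (cmod a)\<^sup>2 + 2 * (cmod b)\<^sup>2"
        using zero_le_power2[of "cmod a - cmod b"] by (simp add: power2_sum power2_diff)
      finally show ?thesis .
    qed
    then show "AE x in leb01. norm ((cmod (f x + g x))\<^sup>2) \<le> norm (2 * (cmod (f x))\<^sup>2 + 2 * (cmod (g x))\<^sup>2)"
      by simp
  qed measurable
  then show ?thesis unfolding L2_01_def by simp
qed

lemma L2_mult_bounded:
  assumes f: "f \<in> L2_01" and g[measurable]: "g \<in> borel_measurable leb01" and B: "\<And>x. x \<in> {0..1} \<Longrightarrow> norm (g x) \<le> B"
  shows "(\<lambda>x. g x * f x) \<in> L2_01"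
proof -
  have [measurable]: "f \<in> borel_measurable leb01" using f unfolding L2_01_def by auto
  have "integrable leb01 (\<lambda>x. (cmod (g x * f x))\<^sup>2)"
  proof (rule Bochner_Integration.integrable_bound)
    show "integrable leb01 (\<lambda>x. B\<^sup>2 * (cmod (f x))\<^sup>2)" using f unfolding L2_01_def by auto
    have "(cmod (g x * f x))\<^sup>2 \<le> B\<^sup>2 * (cmod (f x))\<^sup>2" if "x \<in> {0..1}" for x
      using B[OF that] by (auto simp: norm_mult power_mult_distrib intro!: mult_right_mono power_mono)
    then show "AE x in leb01. norm ((cmod (g x * f x))\<^sup>2) \<le> norm (B\<^sup>2 * (cmod (f x))\<^sup>2)"
      by (intro AE_I2) simp
  qed measurable
  then show ?thesis unfolding L2_01_def by simp
qed

lemma L2_mult_continuous: "f \<in> L2_01 \<Longrightarrow> continuous_on {0..1} g \<Longrightarrow> (\<lambda>x. g x * f x) \<in> L2_01"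
  by (metis L2_mult_bounded continuous_on_unit_bound continuous_leb01_measurable)

lemma L2_bounded: 
  assumes "f \<in> borel_measurable leb01" "\<And>x. x \<in> {0..1} \<Longrightarrow> norm (f x) \<le> B" shows "f \<in> L2_01"
proof -
  interpret finite_measure leb01 by (rule finite_measure_lebesgue_Icc)
  have "(\<lambda>x. f x * 1) \<in> L2_01"
    by (rule L2_mult_bounded) (use assms in \<open>auto simp: L2_01_def\<close>)
  then show ?thesis by simp
qed

lemma L2_continuous: "continuous_on {0..1} f \<Longrightarrow> f \<in> L2_01"
  by (metis L2_bounded continuous_on_unit_bound continuous_leb01_measurable)

lemma L2_cmult: "f \<in> L2_01 \<Longrightarrow> (\<lambda>x. c * f x) \<in> L2_01"
  by (rule L2_mult_bounded[where B = "norm c"]) auto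

lemma L2_0: "(\<lambda>x. 0) \<in> L2_01"
  unfolding L2_01_def by simp

lemma L2_sum: "(\<And>i. i \<in> I \<Longrightarrow> f i \<in> L2_01) \<Longrightarrow> (\<lambda>x. \<Sum>i\<in>I. f i x) \<in> L2_01"
  by (induction I rule: infinite_finite_induct) (auto intro: L2_add L2_0)

text \<open>\<open>F\<close> is absolutely continuous on the unit interval with derivative \<open>f\<close>, expressed by the fundamental theorem of
calculus so that \<open>f\<close> may be changed on null sets.\<close>

definition has_prim_deriv :: "(real \<Rightarrow> complex) \<Rightarrow> (real \<Rightarrow> complex) \<Rightarrow> bool" where
  "has_prim_deriv F f \<longleftrightarrow> integrable leb01 f \<and> (\<forall>x\<in>{0..1}. F x = F 0 + integral {0..x} f)"

lemma has_prim_derivI: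
  "integrable leb01 f \<Longrightarrow> (\<And>x. x \<in> {0..1} \<Longrightarrow> F x = F 0 + integral {0..x} f) \<Longrightarrow> has_prim_deriv F f"
  unfolding has_prim_deriv_def by blast

lemma has_prim_deriv_integrable: "has_prim_deriv F f \<Longrightarrow> integrable leb01 f"
  unfolding has_prim_deriv_def by blast

lemma has_prim_derivD: "has_prim_deriv F f \<Longrightarrow> x \<in> {0..1} \<Longrightarrow> F x = F 0 + integral {0..x} f"
  unfolding has_prim_deriv_def by blast

lemma has_prim_deriv_continuous:
  assumes "has_prim_deriv F f" shows "continuous_on {0..1} F"
proof -
  have "continuous_on {0..1} (\<lambda>x. F 0 + integral {0..x} f)"
    by (intro continuous_intros indefinite_integral_continuous_1 integrable_leb01_on
        has_prim_deriv_integrable[OF assms]) simp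
  then show ?thesis by (rule continuous_on_eq) (rule has_prim_derivD[OF assms, symmetric])
qed

lemma has_prim_deriv_add:
  assumes F: "has_prim_deriv F f" and G: "has_prim_deriv G g"
  shows "has_prim_deriv (\<lambda>x. F x + G x) (\<lambda>x. f x + g x)"
proof (rule has_prim_derivI)
  note int = has_prim_deriv_integrable[OF F] has_prim_deriv_integrable[OF G]
  show "integrable leb01 (\<lambda>x. f x + g x)" using int by simp
  fix x :: real assume x: "x \<in> {0..1}"
  have "integral {0..x} (\<lambda>x. f x + g x) = integral {0..x} f + integral {0..x} g"
    by (rule integral_add) (auto intro: integrable_leb01_on int x)
  then show "F x + G x = F 0 + G 0 + integral {0..x} (\<lambda>x. f x + g x)"
    unfolding has_prim_derivD[OF F x] has_prim_derivD[OF G x] by simp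
qed

lemma has_prim_deriv_cmult:
  assumes F: "has_prim_deriv F f" shows "has_prim_deriv (\<lambda>x. c * F x) (\<lambda>x. c * f x)"
proof (rule has_prim_derivI)
  show "integrable leb01 (\<lambda>x. c * f x)" using has_prim_deriv_integrable[OF F] by simp
  show "c * F x = c * F 0 + integral {0..x} (\<lambda>x. c * f x)" if "x \<in> {0..1}" for x
    by (metis distrib_left integral_mult_right has_prim_derivD[OF F that])
qed

lemma has_prim_deriv_0: "has_prim_deriv (\<lambda>x. 0) (\<lambda>x. 0)"
  unfolding has_prim_deriv_def by simp

lemma has_prim_deriv_sum:
  "(\<And>i. i \<in> I \<Longrightarrow> has_prim_deriv (F i) (f i)) \<Longrightarrow> has_prim_deriv (\<lambda>x. \<Sum>i\<in>I. F i x) (\<lambda>x. \<Sum>i\<in>I. f i x)"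
  by (induction I rule: infinite_finite_induct) (auto intro: has_prim_deriv_add has_prim_deriv_0)

lemma has_prim_deriv_AE:
  assumes F: "has_prim_deriv F f" and eq: "\<And>x. x \<in> {0..1} \<Longrightarrow> F x = G x" "AE x in leb01. f x = g x"
  shows "has_prim_deriv G g"
proof (rule has_prim_derivI)
  note int = has_prim_deriv_integrable[OF F]
  show "integrable leb01 g" by (rule integrable_leb_AE[OF int eq(2)])
  fix x :: real assume x: "x \<in> {0..1}"
  show "G x = G 0 + integral {0..x} g"
    using has_prim_derivD[OF F x] eq(1)[OF x] eq(1)[of 0] integral_sub_cong_AE[OF int eq(2) x] by simp
qed

lemma has_prim_deriv_C1:
  assumes d: "\<And>x. x \<in> {0..1} \<Longrightarrow> (F has_vector_derivative f x) (at x within {0..1})"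
    and c: "continuous_on {0..1} f"
  shows "has_prim_deriv F f"
proof -
  have "F x = F 0 + integral {0..x} f" if x: "x \<in> {0..1}" for x
  proof -
    have "(f has_integral (F x - F 0)) {0..x}"
      by (rule fundamental_theorem_of_calculus)
        (use x in \<open>auto intro: has_vector_derivative_within_subset[OF d]\<close>)
    then show ?thesis by (simp add: integral_unique)
  qed
  then show ?thesis by (rule has_prim_derivI[OF continuous_integrable_leb01[OF c]])
qed

lemma has_prim_deriv_indefinite:
  assumes "integrable leb01 f" shows "has_prim_deriv (\<lambda>x. c + integral {0..x} f) f"
  using assms unfolding has_prim_deriv_def by simp

text \<open>Fubini's theorem: the square \<open>[0,x]\<^sup>2\<close> is cut along its diagonal into two triangles, and the product of the
integrals is the sum of the two iterated integrals over them.\<close>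

lemma integral_product_primitives:
  fixes f g :: "real \<Rightarrow> complex"
  assumes f: "integrable (lebesgue_on {0..x}) f" and g: "integrable (lebesgue_on {0..x}) g"
  defines "M \<equiv> lebesgue_on {0..x}"
  shows "integral\<^sup>L M f * integral\<^sup>L M g =
    (LINT s|M. f s * integral\<^sup>L (lebesgue_on {0..s}) g) + (LINT t|M. g t * integral\<^sup>L (lebesgue_on {0..t}) f)"
proof -
  interpret M: finite_measure M unfolding M_def by (rule finite_measure_lebesgue_Icc)
  interpret P: pair_sigma_finite M M ..
  have [measurable]: "f \<in> borel_measurable M" "g \<in> borel_measurable M" using f g unfolding M_def by auto
  have id[measurable]: "(\<lambda>x. x) \<in> borel_measurable M" unfolding M_def
    by (rule measurable_restrict_space1) (rule measurable_completion, simp)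
  have int: "integrable (M \<Otimes>\<^sub>M M) (\<lambda>(s,t). f s * g t)"
  proof (rule P.Fubini_integrable)
    show "integrable M (\<lambda>s. LINT t|M. norm (case (s, t) of (s, t) \<Rightarrow> f s * g t))"
      using f g unfolding M_def by (simp add: norm_mult)
    show "AE s in M. integrable M (\<lambda>t. case (s, t) of (s, t) \<Rightarrow> f s * g t)"
      using g unfolding M_def by simp
  qed measurable
  define S where "S = {p \<in> space (M \<Otimes>\<^sub>M M). snd p \<le> fst p}"
  have S: "S \<in> sets (M \<Otimes>\<^sub>M M)" unfolding S_def by measurable
  define h1 where "h1 = (\<lambda>p. indicator S p *\<^sub>R (f (fst p) * g (snd p)))"
  define h2 where "h2 = (\<lambda>p. indicator (- S) p *\<^sub>R (f (fst p) * g (snd p)))"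
  have int': "integrable (M \<Otimes>\<^sub>M M) (\<lambda>p. f (fst p) * g (snd p))" using int by (simp add: case_prod_beta')
  have i1: "integrable (M \<Otimes>\<^sub>M M) h1" unfolding h1_def by (rule integrable_mult_indicator[OF S int'])
  have i2: "integrable (M \<Otimes>\<^sub>M M) h2"
    by (rule Bochner_Integration.integrable_cong[THEN iffD1, OF refl _ Bochner_Integration.integrable_diff[OF int' i1]])
      (auto simp: h1_def h2_def split: split_indicator)
  have M: "space M = {0..x}" by (simp add: M_def)
  have inner: "(LINT t|M. indicator {..s} t *\<^sub>R u t) = integral\<^sup>L (lebesgue_on {0..s}) u"
    if s: "s \<in> {0..x}" for s and u :: "real \<Rightarrow> complex"
  proof -
    have "(LINT t|M. indicator {..s} t *\<^sub>R u t) = (LINT t|lebesgue. indicator {0..x} t *\<^sub>R (indicator {..s} t *\<^sub>R u t))"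
      unfolding M_def by (rule integral_restrict_space) simp
    also have "\<dots> = (LINT t|lebesgue. indicator {0..s} t *\<^sub>R u t)"
      by (rule Bochner_Integration.integral_cong) (use s in \<open>auto split: split_indicator\<close>)
    also have "\<dots> = integral\<^sup>L (lebesgue_on {0..s}) u" by (rule integral_restrict_space[symmetric]) simp
    finally show ?thesis .
  qed
  \<comment> \<open>The second triangle is open along the diagonal, which does not change the inner integrals.\<close>
  have inner': "(LINT t|M. indicator {..<s} t *\<^sub>R u t) = integral\<^sup>L (lebesgue_on {0..s}) u"
    if s: "s \<in> {0..x}" and u: "integrable M u" for s and u :: "real \<Rightarrow> complex"
  proof -
    have [measurable]: "u \<in> borel_measurable M" using u by simp
    have [measurable]: "Measurable.pred M (\<lambda>t. t \<in> {..<s})" "Measurable.pred M (\<lambda>t. t \<in> {..s})"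
      by (auto simp: M_def intro!: measurable_restrict_space1 measurable_completion)
    have "AE t in M. t \<noteq> s"
      unfolding M_def by (auto simp: AE_restrict_space_iff intro!: AE_completion AE_I'[of "{s}"])
    then have "(LINT t|M. indicator {..<s} t *\<^sub>R u t) = (LINT t|M. indicator {..s} t *\<^sub>R u t)"
      by (intro integral_cong_AE) (auto elim!: eventually_mono split: split_indicator)
    then show ?thesis using inner[OF s] by simp
  qed
  have fg: "integrable M f" "integrable M g" using f g unfolding M_def by auto
  have "integral\<^sup>L M f * integral\<^sup>L M g = integral\<^sup>L (M \<Otimes>\<^sub>M M) (\<lambda>p. f (fst p) * g (snd p))"
    using P.integral_fst'[OF int] fg by (simp add: case_prod_beta')
  also have "\<dots> = integral\<^sup>L (M \<Otimes>\<^sub>M M) (\<lambda>p. h1 p + h2 p)"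
    by (rule Bochner_Integration.integral_cong) (auto simp: h1_def h2_def split: split_indicator)
  also have "\<dots> = integral\<^sup>L (M \<Otimes>\<^sub>M M) h1 + integral\<^sup>L (M \<Otimes>\<^sub>M M) h2"
    by (rule Bochner_Integration.integral_add[OF i1 i2])
  also have "integral\<^sup>L (M \<Otimes>\<^sub>M M) h1 = (LINT s|M. LINT t|M. h1 (s, t))"
    using P.integral_fst'[OF i1] by simp
  also have "\<dots> = (LINT s|M. f s * integral\<^sup>L (lebesgue_on {0..s}) g)"
  proof (rule Bochner_Integration.integral_cong[OF refl])
    fix s assume s: "s \<in> space M"
    have "(LINT t|M. h1 (s, t)) = (LINT t|M. f s * (indicator {..s} t *\<^sub>R g t))"
      by (rule Bochner_Integration.integral_cong) (use s in \<open>auto simp: h1_def S_def space_pair_measure split: split_indicator\<close>)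
    also have "\<dots> = f s * (LINT t|M. indicator {..s} t *\<^sub>R g t)" by (rule integral_mult_right_zero)
    also have "\<dots> = f s * integral\<^sup>L (lebesgue_on {0..s}) g"
      using inner[of s g] s M by simp
    finally show "(LINT t|M. h1 (s, t)) = f s * integral\<^sup>L (lebesgue_on {0..s}) g" .
  qed
  also have "integral\<^sup>L (M \<Otimes>\<^sub>M M) h2 = (LINT t|M. LINT s|M. h2 (s, t))"
    using P.integral_snd[of "\<lambda>s t. h2 (s, t)"] i2 by simp
  also have "\<dots> = (LINT t|M. g t * integral\<^sup>L (lebesgue_on {0..t}) f)"
  proof (rule Bochner_Integration.integral_cong[OF refl])
    fix t assume t: "t \<in> space M"
    have "(LINT s|M. h2 (s, t)) = (LINT s|M. g t * (indicator {..<t} s *\<^sub>R f s))"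
      by (rule Bochner_Integration.integral_cong) (use t in \<open>auto simp: h2_def S_def space_pair_measure split: split_indicator\<close>)
    also have "\<dots> = g t * (LINT s|M. indicator {..<t} s *\<^sub>R f s)" by (rule integral_mult_right_zero)
    also have "\<dots> = g t * integral\<^sup>L (lebesgue_on {0..t}) f"
      using inner'[OF _ fg(1), of t] t M by simp
    finally show "(LINT s|M. h2 (s, t)) = g t * integral\<^sup>L (lebesgue_on {0..t}) f" .
  qed
  finally show ?thesis .
qed

text \<open>The product rule, without differentiability of the factors at every point: after expanding
\<open>F = F 0 + \<integral>f\<close> and \<open>G = G 0 + \<integral>g\<close> it is the identity of the preceding lemma.\<close>

lemma has_prim_deriv_mult:
  assumes F: "has_prim_deriv F f" and G: "has_prim_deriv G g"
  shows "has_prim_deriv (\<lambda>x. F x * G x) (\<lambda>x. f x * G x + F x * g x)"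
proof (rule has_prim_derivI)
  note f = has_prim_deriv_integrable[OF F] and g = has_prim_deriv_integrable[OF G]
  note cF = has_prim_deriv_continuous[OF F] and cG = has_prim_deriv_continuous[OF G]
  have fG: "integrable leb01 (\<lambda>x. f x * G x)" using integrable_leb01_mult_continuous[OF f cG] by (simp add: mult.commute)
  have Fg: "integrable leb01 (\<lambda>x. F x * g x)" by (rule integrable_leb01_mult_continuous[OF g cF])
  show "integrable leb01 (\<lambda>x. f x * G x + F x * g x)" using fG Fg by simp
  fix x :: real assume x: "x \<in> {0..1}"
  let ?M = "lebesgue_on {0..x}"
  note [simp] = integrable_leb01_sub[OF _ x]
  have eG: "f s * G s = f s * G 0 + f s * integral\<^sup>L (lebesgue_on {0..s}) g" if "s \<in> space ?M" for s
  proof -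
    have s: "s \<in> {0..1}" using x that by auto
    show ?thesis unfolding has_prim_derivD[OF G s] integral_leb01_sub[OF g s] distrib_left ..
  qed
  have eF: "F s * g s = F 0 * g s + g s * integral\<^sup>L (lebesgue_on {0..s}) f" if "s \<in> space ?M" for s
  proof -
    have s: "s \<in> {0..1}" using x that by auto
    show ?thesis unfolding has_prim_derivD[OF F s] integral_leb01_sub[OF f s] by (simp add: algebra_simps)
  qed
  have "integral {0..x} (\<lambda>x. f x * G x + F x * g x) = (LINT s|?M. f s * G s) + (LINT s|?M. F s * g s)"
    using fG Fg x by (simp add: integral_leb01_sub[symmetric])
  also have "(LINT s|?M. f s * G s) = (LINT s|?M. f s * G 0 + f s * integral\<^sup>L (lebesgue_on {0..s}) g)"
    by (rule Bochner_Integration.integral_cong[OF refl eG])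
  also have "(LINT s|?M. F s * g s) = (LINT s|?M. F 0 * g s + g s * integral\<^sup>L (lebesgue_on {0..s}) f)"
    by (rule Bochner_Integration.integral_cong[OF refl eF])
  also have "(LINT s|?M. f s * G 0 + f s * integral\<^sup>L (lebesgue_on {0..s}) g) =
     (LINT s|?M. f s) * G 0 + (LINT s|?M. f s * integral\<^sup>L (lebesgue_on {0..s}) g)"
  proof (subst Bochner_Integration.integral_add)
    have "integrable ?M (\<lambda>s. f s * G s - f s * G 0)" using f fG by simp
    then show "integrable ?M (\<lambda>s. f s * integral\<^sup>L (lebesgue_on {0..s}) g)"
      by (rule Bochner_Integration.integrable_cong[THEN iffD1, OF refl, rotated])
        (use eG in \<open>simp add: algebra_simps\<close>)
  qed (use f in auto)
  also have "(LINT s|?M. F 0 * g s + g s * integral\<^sup>L (lebesgue_on {0..s}) f) =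
     F 0 * (LINT s|?M. g s) + (LINT s|?M. g s * integral\<^sup>L (lebesgue_on {0..s}) f)"
  proof (subst Bochner_Integration.integral_add)
    have "integrable ?M (\<lambda>s. F s * g s - F 0 * g s)" using g Fg by simp
    then show "integrable ?M (\<lambda>s. g s * integral\<^sup>L (lebesgue_on {0..s}) f)"
      by (rule Bochner_Integration.integrable_cong[THEN iffD1, OF refl, rotated])
        (use eF in \<open>simp add: algebra_simps\<close>)
  qed (use g in auto)
  finally have fin: "integral {0..x} (\<lambda>x. f x * G x + F x * g x) = (LINT s|?M. f s) * G 0 + (LINT s|?M. f s * integral\<^sup>L (lebesgue_on {0..s}) g)
    + (F 0 * (LINT s|?M. g s) + (LINT s|?M. g s * integral\<^sup>L (lebesgue_on {0..s}) f))" .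
  have Fx: "F x = F 0 + integral\<^sup>L ?M f" and Gx: "G x = G 0 + integral\<^sup>L ?M g"
    unfolding integral_leb01_sub[OF f x] integral_leb01_sub[OF g x] by (rule has_prim_derivD[OF F x] has_prim_derivD[OF G x])+
  show "F x * G x = F 0 * G 0 + integral {0..x} (\<lambda>x. f x * G x + F x * g x)"
    using integral_product_primitives[OF integrable_leb01_sub[OF f x] integrable_leb01_sub[OF g x]]
    unfolding fin unfolding Fx Gx by (simp add: algebra_simps)
qed

section \<open>Test functions\<close>

text \<open>Being \<open>n\<close> times differentiable, with the derivatives existentially quantified: closure under products and
substitutions then follows by induction, without formulas for higher derivatives.\<close>

fun diff_times :: "nat \<Rightarrow> (real \<Rightarrow> complex) \<Rightarrow> bool" where
  "diff_times 0 f = True"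
| "diff_times (Suc n) f = (\<exists>f'. (\<forall>x. (f has_vector_derivative f' x) (at x)) \<and> diff_times n f')"

lemma diff_times_Suc_imp: "diff_times (Suc n) f \<Longrightarrow> diff_times n f"
proof (induction n arbitrary: f)
  case (Suc n)
  then obtain f' where f': "\<And>x. (f has_vector_derivative f' x) (at x)" "diff_times (Suc n) f'"
    by (metis diff_times.simps(2))
  then have "diff_times n f'" by (intro Suc.IH)
  then show ?case using f'(1) by auto
qed simp

lemma diff_times_add: "diff_times n f \<Longrightarrow> diff_times n g \<Longrightarrow> diff_times n (\<lambda>x. f x + g x)"
proof (induction n arbitrary: f g)
  case (Suc n)
  obtain f' g' where f: "\<And>x. (f has_vector_derivative f' x) (at x)" "diff_times n f'"
    and g: "\<And>x. (g has_vector_derivative g' x) (at x)" "diff_times n g'" using Suc.prems by auto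
  have "((\<lambda>x. f x + g x) has_vector_derivative (f' x + g' x)) (at x)" for x
    by (intro has_vector_derivative_add f g)
  moreover have "diff_times n (\<lambda>x. f' x + g' x)" by (intro Suc.IH f g)
  ultimately show ?case unfolding diff_times.simps by (intro exI[of _ "\<lambda>x. f' x + g' x"]) simp
qed simp

lemma diff_times_mult: "diff_times n f \<Longrightarrow> diff_times n g \<Longrightarrow> diff_times n (\<lambda>x. f x * g x)"
proof (induction n arbitrary: f g)
  case (Suc n)
  obtain f' g' where f: "\<And>x. (f has_vector_derivative f' x) (at x)" "diff_times n f'"
    and g: "\<And>x. (g has_vector_derivative g' x) (at x)" "diff_times n g'" using Suc.prems by auto
  have "((\<lambda>x. f x * g x) has_vector_derivative (f x * g' x + f' x * g x)) (at x)" for x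
    by (intro has_vector_derivative_mult f g)
  moreover have "diff_times n (\<lambda>x. f x * g' x + f' x * g x)"
    by (intro diff_times_add Suc.IH f g diff_times_Suc_imp[OF Suc.prems(1)] diff_times_Suc_imp[OF Suc.prems(2)])
  ultimately show ?case unfolding diff_times.simps by (intro exI[of _ "\<lambda>x. f x * g' x + f' x * g x"]) simp
qed simp

lemma diff_times_const: "diff_times n (\<lambda>x. c)"
proof (induction n arbitrary: c)
  case (Suc n)
  then show ?case unfolding diff_times.simps by (intro exI[of _ "\<lambda>x. 0"]) auto
qed simp

lemma diff_times_affine: "diff_times n f \<Longrightarrow> diff_times n (\<lambda>x. f (a * x + b))"
proof (induction n arbitrary: f)
  case (Suc n)
  obtain f' where f: "\<And>x. (f has_vector_derivative f' x) (at x)" "diff_times n f'" using Suc.prems by auto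
  have "((\<lambda>x. f (a * x + b)) has_vector_derivative (of_real a * f' (a * x + b))) (at x)" for x
  proof -
    have "((\<lambda>x. a * x + b) has_vector_derivative a) (at x)"
      by (auto intro!: derivative_eq_intros simp: has_real_derivative_iff_has_vector_derivative[symmetric])
    from vector_diff_chain_at[OF this f(1)] show ?thesis
      by (simp add: o_def scaleR_conv_of_real)
  qed
  moreover have "diff_times n (\<lambda>x. of_real a * f' (a * x + b))"
    by (intro diff_times_mult diff_times_const Suc.IH f)
  ultimately show ?case unfolding diff_times.simps by (intro exI[of _ "\<lambda>x. of_real a * f' (a * x + b)"]) simp
qed simp

lemma nderiv_within_0 [simp]: "nderiv_within S 0 f = f"
  by (simp add: nderiv_within_def)

lemma nderiv_within_Suc: "nderiv_within S (Suc n) f = (\<lambda>x. vector_derivative (nderiv_within S n f) (at x within S))"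
  by (simp add: nderiv_within_def)

lemma nderiv_within_Suc': "nderiv_within S n (nderiv_within S 1 f) = nderiv_within S (Suc n) f"
  unfolding nderiv_within_def by (metis Suc_eq_plus1 comp_apply funpow_add)

lemma smooth_UNIV_iff_diff_times: "smooth_within UNIV f \<longleftrightarrow> (\<forall>n. diff_times n f)"
proof
  assume s: "smooth_within UNIV f"
  have d: "(nderiv_within UNIV n f has_vector_derivative nderiv_within UNIV (Suc n) f x) (at x)" for n x
    using s unfolding smooth_within_def nderiv_within_Suc by (simp add: vector_derivative_works[symmetric])
  have "diff_times n (nderiv_within UNIV m f)" for n m
  proof (induction n arbitrary: m)
    case (Suc n)
    then show ?case unfolding diff_times.simps using d by blast
  qed simp
  from this[of _ 0] show "\<forall>n. diff_times n f" by simp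
next
  assume *: "\<forall>n. diff_times n f"
  have step: "\<forall>x. g differentiable (at x)" "\<forall>n. diff_times n (\<lambda>x. vector_derivative g (at x))"
    if g: "\<forall>n. diff_times n g" for g
  proof -
    show "\<forall>x. g differentiable (at x)"
      using g[THEN spec, of 1] by (auto intro: differentiableI_vector)
    show "\<forall>n. diff_times n (\<lambda>x. vector_derivative g (at x))"
    proof
      fix n
      obtain g' where g': "\<And>x. (g has_vector_derivative g' x) (at x)" "diff_times n g'"
        using g[THEN spec, of "Suc n"] by auto
      then have "(\<lambda>x. vector_derivative g (at x)) = g'" by (auto intro: vector_derivative_at)
      then show "diff_times n (\<lambda>x. vector_derivative g (at x))" using g'(2) by simp
    qed
  qed
  have "\<forall>k. diff_times k (nderiv_within UNIV n f)" for n
    by (induction n) (use * step in \<open>auto simp: nderiv_within_Suc\<close>)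
  then show "smooth_within UNIV f" unfolding smooth_within_def using step(1) by blast
qed

lemma smooth_UNIV_deriv:
  assumes "smooth_within UNIV f"
  shows "(nderiv_within UNIV n f has_vector_derivative nderiv_within UNIV (Suc n) f x) (at x)"
  using assms unfolding smooth_within_def nderiv_within_Suc by (simp add: vector_derivative_works[symmetric])

lemma poly_exp_tendsto_0: "((\<lambda>t. poly p t * exp (- t)) \<longlongrightarrow> 0) (at_top :: real filter)"
proof -
  have "((\<lambda>t. \<Sum>i\<le>degree p. coeff p i * (t ^ i / exp t)) \<longlongrightarrow> (\<Sum>i\<le>degree p. coeff p i * 0)) (at_top :: real filter)"
    by (intro tendsto_sum tendsto_mult tendsto_const tendsto_power_div_exp_0)
  then show ?thesis by (simp add: poly_altdef exp_minus field_simps sum_divide_distrib)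
qed

text \<open>The functions \<open>p(1/x) exp(-1/x)\<close>, continued by 0, are closed under differentiation, and the one with
\<open>p = 1\<close> is the standard smooth function that is flat at 0.\<close>

definition flat_exp :: "real poly \<Rightarrow> real \<Rightarrow> real" where
  "flat_exp p x = (if x > 0 then poly p (1 / x) * exp (- (1 / x)) else 0)"

lemma flat_exp_deriv: "(flat_exp p has_real_derivative flat_exp ([:0, 0, 1:] * (p - pderiv p)) x) (at x)"
proof -
  consider "x > 0" | "x < 0" | "x = 0" by linarith
  then show ?thesis
  proof cases
    case 1
    have "((\<lambda>x. poly p (1 / x) * exp (- (1 / x))) has_real_derivative
       flat_exp ([:0, 0, 1:] * (p - pderiv p)) x) (at x)"
      using 1 by (auto intro!: derivative_eq_intros simp: flat_exp_def divide_simps power2_eq_square algebra_simps)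
    moreover have "eventually (\<lambda>y. y \<in> {0<..}) (nhds x)" using 1 by (intro eventually_nhds_in_open) auto
    then have "eventually (\<lambda>y. poly p (1 / y) * exp (- (1 / y)) = flat_exp p y) (nhds x)"
      by eventually_elim (simp add: flat_exp_def)
    ultimately show ?thesis by (subst (asm) DERIV_cong_ev[OF refl _ refl])
  next
    case 2
    have "((\<lambda>x. 0::real) has_real_derivative flat_exp ([:0, 0, 1:] * (p - pderiv p)) x) (at x)"
      using 2 by (simp add: flat_exp_def)
    moreover have "eventually (\<lambda>y. y \<in> {..<0}) (nhds x)" using 2 by (intro eventually_nhds_in_open) auto
    then have "eventually (\<lambda>y. 0 = flat_exp p y) (nhds x)"
      by eventually_elim (simp add: flat_exp_def)
    ultimately show ?thesis by (subst (asm) DERIV_cong_ev[OF refl _ refl])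
  next
    case 3
    have "((\<lambda>h. (flat_exp p (0 + h) - flat_exp p 0) / h) \<longlongrightarrow> 0) (at 0)"
    proof (rule filterlim_split_at)
      have "eventually (\<lambda>h. 0 = (flat_exp p (0 + h) - flat_exp p 0) / h) (at_left 0)"
        by (auto simp: eventually_at_filter flat_exp_def)
      then show "((\<lambda>h. (flat_exp p (0 + h) - flat_exp p 0) / h) \<longlongrightarrow> 0) (at_left 0)"
        by (rule Lim_transform_eventually[OF tendsto_const])
      have "((\<lambda>h. poly (pCons 0 p) (inverse h) * exp (- (inverse h))) \<longlongrightarrow> 0) (at_right 0)"
        by (rule filterlim_compose[OF poly_exp_tendsto_0 filterlim_inverse_at_top_right])
      moreover have "eventually (\<lambda>h. poly (pCons 0 p) (inverse h) * exp (- (inverse h)) = (flat_exp p (0 + h) - flat_exp p 0) / h) (at_right 0)"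
        by (auto simp: eventually_at_filter flat_exp_def field_simps)
      ultimately show "((\<lambda>h. (flat_exp p (0 + h) - flat_exp p 0) / h) \<longlongrightarrow> 0) (at_right 0)"
        by (rule Lim_transform_eventually)
    qed
    then show ?thesis using 3 by (simp add: DERIV_def flat_exp_def)
  qed
qed

lemma diff_times_flat_exp: "diff_times n (\<lambda>x. of_real (flat_exp p x))"
proof (induction n arbitrary: p)
  case (Suc n)
  show ?case unfolding diff_times.simps
    by (intro exI[of _ "\<lambda>x. of_real (flat_exp ([:0, 0, 1:] * (p - pderiv p)) x)"] conjI allI
        has_vector_derivative_of_real flat_exp_deriv Suc)
qed simp

text \<open>The product of \<open>exp(-1/(n(x - a)))\<close> and \<open>exp(-1/(n(b - x)))\<close>: as \<open>n\<close> grows both factors tend to 1 inside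
\<open>(a,b)\<close>, so these functions approximate the indicator of the interval boundedly and pointwise.\<close>

definition bump :: "real \<Rightarrow> real \<Rightarrow> nat \<Rightarrow> real \<Rightarrow> complex" where
  "bump a b n x = of_real (flat_exp 1 (real n * x + - real n * a)) * of_real (flat_exp 1 (- real n * x + real n * b))"

lemma flat_exp_1_bounds: "0 \<le> flat_exp 1 x" "flat_exp 1 x \<le> 1"
  by (auto simp: flat_exp_def)

lemma norm_bump_le: "norm (bump a b n x) \<le> 1"
  unfolding bump_def norm_mult norm_of_real using flat_exp_1_bounds by (intro mult_le_one) (auto simp: abs_le_iff intro: order_trans[OF _ flat_exp_1_bounds(1)])

lemma bump_eq_0: "x \<notin> {a<..<b} \<Longrightarrow> bump a b n x = 0"
proof -
  assume "x \<notin> {a<..<b}"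
  then have "real n * (x - a) \<le> 0 \<or> real n * (b - x) \<le> 0" by (auto simp: mult_le_0_iff)
  then show ?thesis by (auto simp: bump_def flat_exp_def algebra_simps)
qed

lemma bump_tendsto: "(\<lambda>n. bump a b n x) \<longlonglongrightarrow> indicator {a<..<b} x"
proof (cases "x \<in> {a<..<b}")
  case False then show ?thesis by (simp add: bump_eq_0)
next
  case True
  have *: "(\<lambda>n. flat_exp 1 (real n * c)) \<longlonglongrightarrow> 1" if "c > 0" for c
  proof -
    have "(\<lambda>n. exp (- (inverse c * (1 / real n)))) \<longlonglongrightarrow> exp (- (inverse c * 0))"
      by (intro tendsto_intros lim_1_over_n)
    moreover have "eventually (\<lambda>n. exp (- (inverse c * (1 / real n))) = flat_exp 1 (real n * c)) sequentially"
      using eventually_gt_at_top[of 0] by eventually_elim (use that in \<open>simp add: flat_exp_def field_simps\<close>)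
    ultimately show ?thesis using Lim_transform_eventually by simp
  qed
  have "(\<lambda>n. complex_of_real (flat_exp 1 (real n * (x - a))) * of_real (flat_exp 1 (real n * (b - x)))) \<longlonglongrightarrow> of_real 1 * of_real 1"
    using True by (intro tendsto_mult tendsto_of_real *) auto
  then show ?thesis using True by (simp add: bump_def algebra_simps)
qed

lemma smooth_bump: "smooth_within UNIV (bump a b n)"
  unfolding smooth_UNIV_iff_diff_times bump_def
  by (intro allI diff_times_mult diff_times_affine[OF diff_times_flat_exp])

lemma test_functions_iff:
  "\<psi> \<in> test_functions \<longleftrightarrow> smooth_within UNIV \<psi> \<and> (\<exists>a b. 0 < a \<and> b < 1 \<and> (\<forall>x. x \<notin> {a..b} \<longrightarrow> \<psi> x = 0))"
proof -
  have "closure {x. \<psi> x \<noteq> 0} \<subseteq> {0<..<1} \<longleftrightarrow> (\<exists>a b. 0 < a \<and> b < 1 \<and> (\<forall>x. x \<notin> {a..b} \<longrightarrow> \<psi> x = 0))"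
    (is "?C \<subseteq> _ \<longleftrightarrow> ?R")
  proof
    assume C: "?C \<subseteq> {0<..<1}"
    show ?R
    proof (cases "?C = {}")
      case True
      then show ?thesis by (intro exI[of _ "1/2"]) auto
    next
      case False
      have "bounded ?C" by (rule bounded_subset[OF bounded_closed_interval[of 0 1]]) (use C in auto)
      then have "compact ?C" by (simp add: compact_eq_bounded_closed)
      from compact_attains_inf[OF this False] compact_attains_sup[OF this False]
      obtain a b where ab: "a \<in> ?C" "\<forall>x\<in>?C. a \<le> x" "b \<in> ?C" "\<forall>x\<in>?C. x \<le> b" by blast
      have zero: "\<psi> x = 0" if "x \<notin> {a..b}" for x
      proof (rule ccontr)
        assume "\<psi> x \<noteq> 0"
        then have "x \<in> ?C" by (intro subsetD[OF closure_subset]) simp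
        then have "a \<le> x" "x \<le> b" using ab(2,4) by blast+
        then show False using that by simp
      qed
      have "0 < a" "b < 1" using subsetD[OF C ab(1)] subsetD[OF C ab(3)] by simp_all
      then show ?thesis using zero by blast
    qed
  next
    assume ?R
    then obtain a b where ab: "0 < a" "b < 1" "\<And>x. x \<notin> {a..b} \<Longrightarrow> \<psi> x = 0" by blast
    have "?C \<subseteq> {a..b}" using ab(3) by (intro closure_minimal closed_atLeastAtMost) blast
    also have "{a..b} \<subseteq> {0<..<1}" using ab by auto
    finally show "?C \<subseteq> {0<..<1}" .
  qed
  then show ?thesis unfolding test_functions_def by simp
qed

lemma bump_test: "0 < a \<Longrightarrow> b < 1 \<Longrightarrow> bump a b n \<in> test_functions"
  unfolding test_functions_iff
  by (rule conjI[OF smooth_bump], rule exI[of _ a], rule exI[of _ b]) (auto intro!: bump_eq_0)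

lemma test_deriv:
  assumes "\<psi> \<in> test_functions"
  shows "nderiv_within UNIV 1 \<psi> \<in> test_functions"
proof -
  obtain a b where s: "smooth_within UNIV \<psi>" and ab: "0 < a" "b < 1" "\<And>x. x \<notin> {a..b} \<Longrightarrow> \<psi> x = 0"
    using assms unfolding test_functions_iff by blast
  have "smooth_within UNIV (nderiv_within UNIV 1 \<psi>)"
    using s unfolding smooth_within_def nderiv_within_Suc' by blast
  moreover have "nderiv_within UNIV 1 \<psi> x = 0" if "x \<notin> {a..b}" for x
  proof -
    have "(\<psi> has_vector_derivative 0) (at x)"
    proof (rule has_vector_derivative_transform_within_open[of "\<lambda>_. 0" _ _ "- {a..b}"])
    qed (use that ab in auto)
    then show ?thesis by (simp add: nderiv_within_Suc vector_derivative_at)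
  qed
  ultimately show ?thesis unfolding test_functions_iff using ab by blast
qed

lemma test_has_deriv:
  assumes "\<psi> \<in> test_functions"
  shows "(\<psi> has_vector_derivative nderiv_within UNIV 1 \<psi> x) (at x)"
  using assms smooth_UNIV_deriv[of \<psi> 0 x] unfolding test_functions_def by simp

lemma test_continuous: "\<psi> \<in> test_functions \<Longrightarrow> continuous_on S \<psi>"
  using test_has_deriv by (meson continuous_at_imp_continuous_on has_vector_derivative_continuous)

lemma test_prim: 
  assumes "\<psi> \<in> test_functions" shows "has_prim_deriv \<psi> (nderiv_within UNIV 1 \<psi>)"
  by (rule has_prim_deriv_C1)
    (use test_has_deriv[OF assms] test_continuous[OF test_deriv[OF assms]] in \<open>auto intro: has_vector_derivative_at_within\<close>)

lemma test_boundary: "\<psi> \<in> test_functions \<Longrightarrow> \<psi> 0 = 0" "\<psi> \<in> test_functions \<Longrightarrow> \<psi> 1 = 0"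
  unfolding test_functions_iff by auto

lemma test_add:
  assumes "\<psi> \<in> test_functions" "\<eta> \<in> test_functions" shows "(\<lambda>x. \<psi> x + c * \<eta> x) \<in> test_functions"
proof -
  obtain a b where 1: "0 < a" "b < 1" "\<And>x. x \<notin> {a..b} \<Longrightarrow> \<psi> x = 0"
    using assms(1) unfolding test_functions_iff by blast
  obtain a' b' where 2: "0 < a'" "b' < 1" "\<And>x. x \<notin> {a'..b'} \<Longrightarrow> \<eta> x = 0"
    using assms(2) unfolding test_functions_iff by blast
  have "smooth_within UNIV (\<lambda>x. \<psi> x + c * \<eta> x)"
    using assms unfolding test_functions_iff smooth_UNIV_iff_diff_times
    by (intro allI diff_times_add diff_times_mult diff_times_const) auto
  moreover have "\<psi> x + c * \<eta> x = 0" if "x \<notin> {min a a'..max b b'}" for x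
  proof -
    have "x \<notin> {a..b}" "x \<notin> {a'..b'}" using that by auto
    then show ?thesis using 1(3) 2(3) by simp
  qed
  moreover have "0 < min a a'" "max b b' < 1" using 1 2 by auto
  ultimately show ?thesis unfolding test_functions_iff by blast
qed

section \<open>The fundamental lemma and weak derivatives\<close>

lemma integrable_mult_test:
  assumes "integrable leb01 q" "\<psi> \<in> test_functions"
  shows "integrable leb01 (\<lambda>x. q x * \<psi> x)"
  using integrable_leb01_mult_continuous[OF assms(1) test_continuous[OF assms(2)]] by (simp add: mult.commute)

text \<open>Testing with bump functions and passing to the limit by dominated convergence.\<close>

lemma integral_interval_eq_0:
  assumes q: "integrable leb01 q" and 0: "\<And>\<psi>. \<psi> \<in> test_functions \<Longrightarrow> (LINT x|leb01. q x * \<psi> x) = 0"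
    and ab: "0 < a" "a \<le> b" "b < 1"
  shows "integral {a..b} q = 0"
proof -
  have [measurable]: "q \<in> borel_measurable leb01" using q by simp
  have bump_m[measurable]: "bump a b n \<in> borel_measurable leb01" for n
    by (rule continuous_leb01_measurable[OF test_continuous[OF bump_test]]) (use ab in auto)
  have ind_m[measurable]: "(\<lambda>x. indicator {a<..<b} x :: complex) \<in> borel_measurable leb01"
    by (intro measurable_restrict_space1 measurable_completion) simp
  have "(\<lambda>n. LINT x|leb01. q x * bump a b n x) \<longlonglongrightarrow> (LINT x|leb01. q x * indicator {a<..<b} x)"
  proof (rule integral_dominated_convergence[where w = "\<lambda>x. norm (q x)"])
    show "AE x in leb01. (\<lambda>n. q x * bump a b n x) \<longlonglongrightarrow> q x * indicator {a<..<b} x"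
      by (intro AE_I2 tendsto_mult tendsto_const bump_tendsto)
    show "AE x in leb01. norm (q x * bump a b n x) \<le> norm (q x)" for n
      using norm_bump_le by (intro AE_I2) (simp add: norm_mult mult_left_le)
  qed (use q in auto)
  moreover have "(LINT x|leb01. q x * bump a b n x) = 0" for n
    by (rule 0[OF bump_test]) (use ab in auto)
  ultimately have "(LINT x|leb01. q x * indicator {a<..<b} x) = 0"
    by (simp add: LIMSEQ_const_iff)
  moreover have "integrable leb01 (\<lambda>x. q x * indicator {a<..<b} x)"
    by (rule Bochner_Integration.integrable_bound[OF q]) (auto split: split_indicator)
  ultimately have "integral {0..1} (\<lambda>x. q x * indicator {a<..<b} x) = 0"
    using lebesgue_integral_eq_integral by fastforce
  also have "(\<lambda>x. q x * indicator {a<..<b} x) = (\<lambda>x. if x \<in> {a<..<b} then q x else 0)" by auto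
  finally have "integral ({a<..<b} \<inter> {0..1}) q = 0" unfolding Henstock_Kurzweil_Integration.integral_restrict_Int .
  moreover have "{a<..<b} \<inter> {0..1} = {a<..<b}" using ab by auto
  ultimately show ?thesis by (simp add: integral_open_interval_real)
qed

lemma AE_leb01_I:
  assumes "negligible N" "\<And>x. x \<in> {0..1} \<Longrightarrow> x \<notin> N \<Longrightarrow> P x"
  shows "AE x in leb01. P x"
proof -
  have "N \<in> null_sets lebesgue" using assms(1) by (simp add: negligible_iff_null_sets)
  then have "AE x in lebesgue. x \<notin> N" by (rule AE_not_in)
  then show ?thesis using assms(2) by (auto simp: AE_restrict_space_iff elim!: eventually_mono)
qed

text \<open>All integrals over small intervals vanish, and by Lebesgue's differentiation theorem almost every value is
a limit of averages over such intervals.\<close>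

lemma fundamental_lemma:
  assumes q: "integrable leb01 q" and 0: "\<And>\<psi>. \<psi> \<in> test_functions \<Longrightarrow> (LINT x|leb01. q x * \<psi> x) = 0"
  shows "AE x in leb01. q x = 0"
proof -
  define f where "f = (\<lambda>x. if x \<in> {0..1} then q x else 0)"
  have q01: "q absolutely_integrable_on {0..1}"
    using q by (simp add: set_integrable_def integrable_restrict_space)
  have "f absolutely_integrable_on UNIV"
    unfolding f_def absolutely_integrable_restrict_UNIV by (rule q01)
  then have fint: "f integrable_on UNIV" by (simp add: absolutely_integrable_on_def)
  have "f integrable_on cbox a b" for a b
    by (rule integrable_on_subcbox[OF fint]) simp
  then obtain N where N: "negligible N"
    "\<And>x e. \<lbrakk>x \<notin> N; 0 < e\<rbrakk> \<Longrightarrow> \<exists>d>0. \<forall>h. 0 < h \<and> h < d \<longrightarrow> norm(integral (cbox x (x + h *\<^sub>R One)) f /\<^sub>R h ^ DIM(real) - f x) < e"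
    using integrable_ccontinuous_explicit[of f] by metis
  show ?thesis
  proof (rule AE_leb01_I)
    show "negligible (insert 0 (insert 1 N))" using N(1) by simp
    fix x :: real assume x: "x \<in> {0..1}" "x \<notin> insert 0 (insert 1 N)"
    have "norm (f x) < e" if "e > 0" for e
    proof -
      have "\<exists>d>0. \<forall>h. 0 < h \<and> h < d \<longrightarrow> norm(integral {x..x + h} f /\<^sub>R h - f x) < e"
        using N(2)[OF _ that, of x] x(2) by simp
      then obtain d where d: "d > 0" "\<And>h. 0 < h \<Longrightarrow> h < d \<Longrightarrow> norm(integral {x..x + h} f /\<^sub>R h - f x) < e"
        by blast
      define h where "h = min (d / 2) ((1 - x) / 2)"
      have "0 < x" "x < 1" using x by auto
      then have h: "0 < h" "h < d" "x + h < 1" using d(1) unfolding h_def by (auto simp: min_def field_simps)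
      have "integral {x..x + h} f = integral {x..x + h} q"
        by (rule Henstock_Kurzweil_Integration.integral_cong) (use h x in \<open>auto simp: f_def\<close>)
      also have "\<dots> = 0" by (rule integral_interval_eq_0[OF q 0]) (use h x in auto)
      finally show ?thesis using d(2)[OF h(1,2)] by simp
    qed
    then have "f x = 0" by (metis less_irrefl zero_less_norm_iff)
    then show "q x = 0" using x by (simp add: f_def)
  qed
qed

lemma leb01_not_null: "\<not> (AE x in leb01. False)"
proof
  assume "AE x in leb01. False"
  then have "AE x in leb01. x \<notin> space leb01" by (rule eventually_mono) simp
  then have "space leb01 \<in> null_sets leb01" by (subst AE_iff_null_sets) auto
  then have "emeasure leb01 (space leb01) = 0" by (rule null_setsD1)
  then show False by (simp add: emeasure_restrict_space)
qed

lemma test_integral: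
  assumes "\<psi> \<in> test_functions" shows "(LINT x|leb01. \<psi> x) = integral {0..1} \<psi>"
  by (rule lebesgue_integral_eq_integral[OF continuous_integrable_leb01[OF test_continuous[OF assms]]]) simp

text \<open>The primitive from the left end vanishes to the left of the support, and, because the total integral
is 0, also to the right of it.\<close>

lemma test_antideriv:
  assumes \<theta>: "\<theta> \<in> test_functions" and 0: "(LINT x|leb01. \<theta> x) = 0"
  obtains \<Theta> where "\<Theta> \<in> test_functions" "nderiv_within UNIV 1 \<Theta> = \<theta>"
proof -
  obtain a b where s: "smooth_within UNIV \<theta>" and ab: "0 < a" "b < 1" "\<And>x. x \<notin> {a..b} \<Longrightarrow> \<theta> x = 0"
    using \<theta> unfolding test_functions_iff by blast
  define \<Theta> where "\<Theta> = (\<lambda>x. integral {0..x} \<theta>)"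
  have cont: "continuous_on S \<theta>" for S by (rule test_continuous[OF \<theta>])
  have left: "\<Theta> x = 0" if "x < a" for x
  proof -
    have "\<Theta> x = integral {0..x} (\<lambda>x. 0)" unfolding \<Theta>_def
      by (rule Henstock_Kurzweil_Integration.integral_cong) (use that ab in auto)
    then show ?thesis by simp
  qed
  have right: "\<Theta> x = 0" if "b < x" for x
  proof (cases "x \<ge> 0")
    case True
    \<comment> \<open>A common interval for the integrals up to \<open>x\<close> and up to 1, since \<open>x\<close> may lie on either side of 1.\<close>
    define y where "y = max x 1"
    have "integral {0..x} \<theta> + integral {x..y} \<theta> = integral {0..y} \<theta>"
      by (rule Henstock_Kurzweil_Integration.integral_combine) (use True in \<open>auto simp: y_def intro: integrable_continuous_real cont\<close>)
    moreover have "integral {0..1} \<theta> + integral {1..y} \<theta> = integral {0..y} \<theta>"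
      by (rule Henstock_Kurzweil_Integration.integral_combine) (auto simp: y_def intro: integrable_continuous_real cont)
    moreover have "integral {x..y} \<theta> = integral {x..y} (\<lambda>x. 0)"
      by (rule Henstock_Kurzweil_Integration.integral_cong) (use that ab in auto)
    moreover have "integral {1..y} \<theta> = integral {1..y} (\<lambda>x. 0)"
      by (rule Henstock_Kurzweil_Integration.integral_cong) (use that ab in auto)
    ultimately show ?thesis using 0 test_integral[OF \<theta>] by (simp add: \<Theta>_def)
  next
    case False then show ?thesis by (simp add: \<Theta>_def)
  qed
  have deriv: "(\<Theta> has_vector_derivative \<theta> x) (at x)" for x
  proof (cases "x < a")
    case True
    have "(\<Theta> has_vector_derivative 0) (at x)"
    proof (rule has_vector_derivative_transform_within_open[of "\<lambda>_. 0" _ _ "{..<a}"])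
    qed (use left True in auto)
    then show ?thesis using True ab(3) by simp
  next
    case False
    then have "x > 0" using ab by simp
    have "(\<Theta> has_vector_derivative \<theta> x) (at x within {0..x+1})"
      unfolding \<Theta>_def by (rule integral_has_vector_derivative[OF cont]) (use \<open>x > 0\<close> in auto)
    then have "(\<Theta> has_vector_derivative \<theta> x) (at x within {0<..<x+1})"
      by (rule has_vector_derivative_within_subset) auto
    then show ?thesis using \<open>x > 0\<close> by (simp add: at_within_open[of x "{0<..<x+1}"])
  qed
  have "diff_times n \<Theta>" for n
  proof (rule diff_times_Suc_imp)
    show "diff_times (Suc n) \<Theta>" unfolding diff_times.simps
      using deriv s smooth_UNIV_iff_diff_times by blast
  qed
  then have "\<Theta> \<in> test_functions" unfolding test_functions_iff smooth_UNIV_iff_diff_times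
    using left right ab by (intro conjI allI exI[of _ a] exI[of _ b]) (auto simp: not_le)
  moreover have "nderiv_within UNIV 1 \<Theta> = \<theta>"
    using deriv by (auto simp: nderiv_within_Suc vector_derivative_at)
  ultimately show thesis by (rule that)
qed

text \<open>Subtracting from a test function a multiple of a fixed one with integral different from 0 leaves the
derivative of a test function. Hence \<open>q\<close> acts on all test functions like a constant.\<close>

lemma du_Bois_Reymond:
  assumes q: "integrable leb01 q"
    and 0: "\<And>\<psi>. \<psi> \<in> test_functions \<Longrightarrow> (LINT x|leb01. q x * nderiv_within UNIV 1 \<psi> x) = 0"
  obtains c where "AE x in leb01. q x = c"
proof -
  interpret finite_measure leb01 by (rule finite_measure_lebesgue_Icc)
  \<comment> \<open>If all test functions had integral 0, the fundamental lemma would give \<open>1 = 0\<close> almost everywhere.\<close>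
  have "\<exists>\<psi>\<in>test_functions. (LINT x|leb01. \<psi> x) \<noteq> 0"
  proof (rule ccontr)
    assume "\<not> ?thesis"
    then have "AE x in leb01. (1::complex) = 0" by (intro fundamental_lemma) auto
    then show False using leb01_not_null by simp
  qed
  then obtain \<psi>0 where \<psi>0: "\<psi>0 \<in> test_functions" "(LINT x|leb01. \<psi>0 x) \<noteq> 0" by blast
  define c where "c = (LINT x|leb01. q x * \<psi>0 x) / (LINT x|leb01. \<psi>0 x)"
  have "AE x in leb01. q x - c = 0"
  proof (rule fundamental_lemma)
    show "integrable leb01 (\<lambda>x. q x - c)" using q by simp
    fix \<psi> assume \<psi>: "\<psi> \<in> test_functions"
    note I[simp] = continuous_integrable_leb01[OF test_continuous] integrable_mult_test[OF q]
    define r where "r = (LINT x|leb01. \<psi> x) / (LINT x|leb01. \<psi>0 x)"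
    have "(\<lambda>x. \<psi> x + (- r) * \<psi>0 x) \<in> test_functions" by (rule test_add[OF \<psi> \<psi>0(1)])
    moreover have "(LINT x|leb01. \<psi> x + (- r) * \<psi>0 x) = 0"
      using \<psi> \<psi>0 by (simp add: r_def)
    ultimately obtain \<Theta> where "\<Theta> \<in> test_functions" "nderiv_within UNIV 1 \<Theta> = (\<lambda>x. \<psi> x + (- r) * \<psi>0 x)"
      by (rule test_antideriv)
    then have "(LINT x|leb01. q x * (\<psi> x + (- r) * \<psi>0 x)) = 0" using 0 by metis
    also have "(LINT x|leb01. q x * (\<psi> x + (- r) * \<psi>0 x)) = (LINT x|leb01. q x * \<psi> x + (- r) * (q x * \<psi>0 x))"
      by (simp add: algebra_simps)
    also have "\<dots> = (LINT x|leb01. q x * \<psi> x) - r * (LINT x|leb01. q x * \<psi>0 x)"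
      using \<psi> \<psi>0 by (subst Bochner_Integration.integral_add) auto
    also have "\<dots> = (LINT x|leb01. q x * \<psi> x) - c * (LINT x|leb01. \<psi> x)"
      by (simp add: r_def c_def)
    also have "\<dots> = (LINT x|leb01. (q x - c) * \<psi> x)"
      unfolding left_diff_distrib using \<psi> by (subst Bochner_Integration.integral_diff) auto
    finally show "(LINT x|leb01. (q x - c) * \<psi> x) = 0" .
  qed
  then have "AE x in leb01. q x = c" by simp
  then show thesis by (rule that)
qed

lemma integration_by_parts_test:
  assumes F: "has_prim_deriv F f" and \<psi>: "\<psi> \<in> test_functions"
  shows "(LINT x|leb01. F x * nderiv_within UNIV 1 \<psi> x) = - (LINT x|leb01. f x * \<psi> x)"
proof -
  have p: "has_prim_deriv (\<lambda>x. F x * \<psi> x) (\<lambda>x. f x * \<psi> x + F x * nderiv_within UNIV 1 \<psi> x)"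
    by (rule has_prim_deriv_mult[OF F test_prim[OF \<psi>]])
  have i1: "integrable leb01 (\<lambda>x. f x * \<psi> x)" by (rule integrable_mult_test[OF has_prim_deriv_integrable[OF F] \<psi>])
  have i2: "integrable leb01 (\<lambda>x. F x * nderiv_within UNIV 1 \<psi> x)"
    by (rule integrable_leb01_mult_continuous[OF continuous_integrable_leb01[OF test_continuous[OF test_deriv[OF \<psi>]]] has_prim_deriv_continuous[OF F]])
  have "integral {0..1} (\<lambda>x. f x * \<psi> x + F x * nderiv_within UNIV 1 \<psi> x) = 0"
    using has_prim_derivD[OF p, of 1] test_boundary[OF \<psi>] by simp
  then have "(LINT x|leb01. f x * \<psi> x + F x * nderiv_within UNIV 1 \<psi> x) = 0"
    using integral_leb01_sub[OF has_prim_deriv_integrable[OF p], of 1] by simp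
  then show ?thesis using i1 i2 by (simp add: eq_neg_iff_add_eq_0 add.commute)
qed

lemma has_weak_derivD:
  "has_weak_deriv n u g \<Longrightarrow> \<psi> \<in> test_functions \<Longrightarrow>
     (LINT x|leb01. u x * nderiv_within UNIV n \<psi> x) = (-1) ^ n * (LINT x|leb01. g x * \<psi> x)"
  unfolding has_weak_deriv_def by blast

lemma weak_deriv_unique:
  assumes g: "has_weak_deriv n u g" and h: "has_weak_deriv n u h"
  shows "AE x in leb01. g x = h x"
proof -
  have int: "integrable leb01 g" "integrable leb01 h" using g h unfolding has_weak_deriv_def by auto
  have "AE x in leb01. g x - h x = 0"
  proof (rule fundamental_lemma)
    fix \<psi> assume \<psi>: "\<psi> \<in> test_functions"
    have "(-1) ^ n * (LINT x|leb01. g x * \<psi> x) = (-1) ^ n * (LINT x|leb01. h x * \<psi> x)"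
      using has_weak_derivD[OF g \<psi>] has_weak_derivD[OF h \<psi>] by (rule trans[OF sym])
    then have "(LINT x|leb01. g x * \<psi> x) = (LINT x|leb01. h x * \<psi> x)"
      by (subst (asm) mult_left_cancel) auto
    then show "(LINT x|leb01. (g x - h x) * \<psi> x) = 0"
      unfolding left_diff_distrib using integrable_mult_test[OF int(1) \<psi>] integrable_mult_test[OF int(2) \<psi>] by simp
  qed (use int in simp)
  then show ?thesis by simp
qed

section \<open>Sobolev functions as chains of primitives\<close>

text \<open>A function of class \<open>H\<^sup>m\<close>, \<open>m \<ge> 1\<close>, on an interval has \<open>m - 1\<close> classical derivatives, the last of which is absolutely continuous.
A chain records all of them as functions, so that Leibniz's formula and the traces can be read off.\<close>

definition deriv_chain :: "nat \<Rightarrow> (nat \<Rightarrow> real \<Rightarrow> complex) \<Rightarrow> bool" where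
  "deriv_chain m F \<longleftrightarrow> (\<forall>j\<le>m. F j \<in> L2_01) \<and> (\<forall>j<m. has_prim_deriv (F j) (F (Suc j)))"

text \<open>The values \<open>F j y\<close> for \<open>j < m\<close> at an endpoint \<open>y\<close> are the traces of the derivatives of \<open>u\<close>.\<close>

definition sobolev_rep :: "nat \<Rightarrow> (real \<Rightarrow> complex) \<Rightarrow> (nat \<Rightarrow> real \<Rightarrow> complex) \<Rightarrow> bool" where
  "sobolev_rep m u F \<longleftrightarrow> deriv_chain m F \<and> (AE x in leb01. u x = F 0 x)"

lemma sobolev_rep_mono: "sobolev_rep m u F \<Longrightarrow> k \<le> m \<Longrightarrow> sobolev_rep k u F"
  unfolding sobolev_rep_def deriv_chain_def by auto

lemma sobolev_rep_L2: "sobolev_rep m u F \<Longrightarrow> u \<in> L2_01"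
  unfolding sobolev_rep_def deriv_chain_def by (blast intro: L2_AE AE_symmetric)

lemma sobolev_rep_weak_deriv:
  assumes F: "sobolev_rep m u F" and j: "j \<le> m"
  shows "has_weak_deriv j u (F j)"
proof -
  have L2: "\<And>i. i \<le> m \<Longrightarrow> integrable leb01 (F i)" using F unfolding sobolev_rep_def deriv_chain_def by (auto intro: L2_integrable)
  have u: "integrable leb01 u" by (rule L2_integrable[OF sobolev_rep_L2[OF F]])
  have "\<forall>\<psi>\<in>test_functions. (LINT x|leb01. u x * nderiv_within UNIV j \<psi> x) = (-1) ^ j * (LINT x|leb01. F j x * \<psi> x)"
    using j
  proof (induction j)
    case 0
    show ?case
    proof
      fix \<psi> assume \<psi>: "\<psi> \<in> test_functions"
      have "(LINT x|leb01. u x * \<psi> x) = (LINT x|leb01. F 0 x * \<psi> x)"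
      proof (rule integral_cong_AE)
        show "AE x in leb01. u x * \<psi> x = F 0 x * \<psi> x"
          using F[unfolded sobolev_rep_def, THEN conjunct2] by eventually_elim simp
      qed (auto intro!: borel_measurable_integrable integrable_mult_test u L2 \<psi>)
      then show "(LINT x|leb01. u x * nderiv_within UNIV 0 \<psi> x) = (-1) ^ 0 * (LINT x|leb01. F 0 x * \<psi> x)" by simp
    qed
  next
    case (Suc j)
    show ?case
    proof
      fix \<psi> assume \<psi>: "\<psi> \<in> test_functions"
      have "has_prim_deriv (F j) (F (Suc j))" using F Suc.prems unfolding sobolev_rep_def deriv_chain_def by auto
      from integration_by_parts_test[OF this \<psi>]
      show "(LINT x|leb01. u x * nderiv_within UNIV (Suc j) \<psi> x) = (-1) ^ Suc j * (LINT x|leb01. F (Suc j) x * \<psi> x)"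
        using Suc.IH[OF Suc_leD[OF Suc.prems]] test_deriv[OF \<psi>]
        unfolding nderiv_within_Suc'[symmetric] by simp
    qed
  qed
  then show ?thesis unfolding has_weak_deriv_def using u L2 j by blast
qed

lemma sobolev_rep_imp_sobolev:
  assumes F: "sobolev_rep m u F" shows "u \<in> sobolev m"
  unfolding sobolev_def
proof (intro CollectI conjI allI impI)
  show "u \<in> L2_01" by (rule sobolev_rep_L2[OF F])
  fix j assume j: "j \<le> m"
  have "F j \<in> L2_01" using F j unfolding sobolev_rep_def deriv_chain_def by blast
  then show "\<exists>g\<in>L2_01. has_weak_deriv j u g" using sobolev_rep_weak_deriv[OF F j] by blast
qed

text \<open>Each weak derivative has the next one as its own first weak derivative, so by the lemma of du
Bois-Reymond it is almost everywhere a primitive of it.\<close>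

lemma sobolev_imp_sobolev_rep:
  assumes "u \<in> sobolev m" obtains F where "sobolev_rep m u F"
proof -
  obtain g where g: "\<And>j. j \<le> m \<Longrightarrow> g j \<in> L2_01" "\<And>j. j \<le> m \<Longrightarrow> has_weak_deriv j u (g j)"
    using assms unfolding sobolev_def by (auto simp: Bex_def) metis
  have "\<exists>G. (AE x in leb01. g j x = G x) \<and> (j < m \<longrightarrow> has_prim_deriv G (g (Suc j)))" if j: "j \<le> m" for j
  proof (cases "j < m")
    case True
    define h where "h = g (Suc j)"
    have h: "integrable leb01 h" using g(1)[of "Suc j"] True by (simp add: h_def L2_integrable)
    have gj: "integrable leb01 (g j)" using g(1)[OF j] by (rule L2_integrable)
    let ?H = "\<lambda>x. 0 + integral {0..x} h"
    have H: "has_prim_deriv ?H h" by (rule has_prim_deriv_indefinite[OF h])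
    have Hi: "integrable leb01 ?H" by (rule continuous_integrable_leb01[OF has_prim_deriv_continuous[OF H]])
    obtain c where c: "AE x in leb01. g j x - ?H x = c"
    proof (rule du_Bois_Reymond)
      show "integrable leb01 (\<lambda>x. g j x - ?H x)" using gj Hi by simp
      fix \<psi> assume \<psi>: "\<psi> \<in> test_functions"
      note d = test_deriv[OF \<psi>]
      have "(-1) ^ j * (LINT x|leb01. g j x * nderiv_within UNIV 1 \<psi> x) = (LINT x|leb01. u x * nderiv_within UNIV (Suc j) \<psi> x)"
        using g(2)[OF j] d unfolding has_weak_deriv_def nderiv_within_Suc'[symmetric] by auto
      also have "\<dots> = (-1) ^ Suc j * (LINT x|leb01. h x * \<psi> x)"
        using g(2)[of "Suc j"] True \<psi> unfolding has_weak_deriv_def h_def by auto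
      finally have "(-1) ^ j * (LINT x|leb01. g j x * nderiv_within UNIV 1 \<psi> x) = (-1) ^ j * (- (LINT x|leb01. h x * \<psi> x))"
        by (simp only: power_Suc) simp
      then have "(LINT x|leb01. g j x * nderiv_within UNIV 1 \<psi> x) = - (LINT x|leb01. h x * \<psi> x)"
        by (subst (asm) mult_left_cancel) auto
      then show "(LINT x|leb01. (g j x - ?H x) * nderiv_within UNIV 1 \<psi> x) = 0"
        using integration_by_parts_test[OF H \<psi>] integrable_mult_test[OF gj d] integrable_mult_test[OF Hi d]
        unfolding left_diff_distrib by (subst Bochner_Integration.integral_diff) simp_all
    qed
    show ?thesis
      by (rule exI[of _ "\<lambda>x. c + integral {0..x} h"])
        (use c has_prim_deriv_indefinite[OF h, of c] in \<open>auto simp: h_def[symmetric] algebra_simps elim!: eventually_mono\<close>)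
  next
    case False
    then show ?thesis by (intro exI[of _ "g j"]) simp
  qed
  then obtain G where G: "\<And>j. j \<le> m \<Longrightarrow> AE x in leb01. g j x = G j x" "\<And>j. j < m \<Longrightarrow> has_prim_deriv (G j) (g (Suc j))"
    by (metis less_imp_le)
  have "has_prim_deriv (G j) (G (Suc j))" if "j < m" for j
    by (rule has_prim_deriv_AE[OF G(2)[OF that] _ G(1)]) (use that in auto)
  moreover have "G j \<in> L2_01" if "j \<le> m" for j by (rule L2_AE[OF g(1)[OF that] G(1)[OF that]])
  moreover have "AE x in leb01. u x = G 0 x"
  proof -
    have "has_weak_deriv 0 u u"
      using assms unfolding has_weak_deriv_def sobolev_def by (auto intro: L2_integrable)
    from weak_deriv_unique[OF this g(2)[OF le0]] G(1)[OF le0] show ?thesis by eventually_elim simp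
  qed
  ultimately have "sobolev_rep m u G" unfolding sobolev_rep_def deriv_chain_def by blast
  then show thesis by (rule that)
qed

lemma weak_deriv_sobolev_rep:
  assumes "sobolev_rep m u F" "j \<le> m" shows "AE x in leb01. weak_deriv j u x = F j x"
  unfolding weak_deriv_def
  using weak_deriv_unique[OF someI[of "has_weak_deriv j u", OF sobolev_rep_weak_deriv[OF assms]] sobolev_rep_weak_deriv[OF assms]] .

text \<open>The primitives of the two functions agree, and so do their derivatives, also at the endpoints.\<close>

lemma continuous_AE_eq:
  fixes f g :: "real \<Rightarrow> complex"
  assumes f: "continuous_on {0..1} f" and g: "continuous_on {0..1} g"
    and ae: "AE x in leb01. f x = g x" and z: "z \<in> {0..1}"
  shows "f z = g z"
proof -
  have I: "integral {0..x} f = integral {0..x} g" if "x \<in> {0..1}" for x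
    by (rule integral_sub_cong_AE[OF continuous_integrable_leb01[OF f] ae that])
  have "((\<lambda>x. integral {0..x} f) has_vector_derivative f z) (at z within {0..1})"
    by (rule integral_has_vector_derivative[OF f z])
  moreover have "((\<lambda>x. integral {0..x} f) has_vector_derivative g z) (at z within {0..1})"
    by (rule has_vector_derivative_transform[OF z _ integral_has_vector_derivative[OF g z]]) (rule I)
  ultimately show ?thesis
    using vector_derivative_unique_within_closed_interval[of 0 1 z _ "f z" "g z"] z by simp
qed

lemma trace_at_sobolev_rep:
  assumes F: "sobolev_rep m u F" and m: "1 \<le> m" and z: "z \<in> {0..1}"
  shows "trace_at u z = F 0 z"
  unfolding trace_at_def
proof (rule the_equality)
  have c: "continuous_on {0..1} (F 0)" using F m unfolding sobolev_rep_def deriv_chain_def by (auto intro: has_prim_deriv_continuous)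
  show "\<exists>g. continuous_on {0..1} g \<and> (AE x in leb01. u x = g x) \<and> g z = F 0 z"
    using c F unfolding sobolev_rep_def by blast
  fix d assume "\<exists>g. continuous_on {0..1} g \<and> (AE x in leb01. u x = g x) \<and> g z = d"
  then obtain g where g: "continuous_on {0..1} g" "AE x in leb01. u x = g x" "g z = d" by blast
  have "AE x in leb01. g x = F 0 x" using g(2) F[unfolded sobolev_rep_def, THEN conjunct2] by eventually_elim simp
  from continuous_AE_eq[OF g(1) c this z] g(3) show "d = F 0 z" by simp
qed

section \<open>Multiplication by smooth functions and the Schroedinger operator\<close>

definition smooth_seq :: "(nat \<Rightarrow> real \<Rightarrow> complex) \<Rightarrow> bool" where
  "smooth_seq \<Phi> \<longleftrightarrow> (\<forall>j. has_prim_deriv (\<Phi> j) (\<Phi> (Suc j)))"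

definition derivs01 :: "(real \<Rightarrow> real) \<Rightarrow> nat \<Rightarrow> real \<Rightarrow> complex" where
  "derivs01 f j x = of_real (nderiv_within {0..1} j f x)"

lemma smooth_seq_derivs01:
  assumes "smooth_within {0..1} f" shows "smooth_seq (derivs01 f)"
  unfolding smooth_seq_def
proof
  fix j
  have d: "(nderiv_within {0..1} j f has_vector_derivative nderiv_within {0..1} (Suc j) f x) (at x within {0..1})"
    if "x \<in> {0..1}" for j x
    using assms that unfolding smooth_within_def nderiv_within_Suc by (simp add: vector_derivative_works[symmetric])
  have d': "(derivs01 f j has_vector_derivative derivs01 f (Suc j) x) (at x within {0..1})"
    if "x \<in> {0..1}" for j x
    unfolding derivs01_def
    by (rule has_vector_derivative_of_real) (use d[OF that] in \<open>simp add: has_real_derivative_iff_has_vector_derivative\<close>)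
  have "continuous_on {0..1} (derivs01 f (Suc j))"
    unfolding continuous_on_eq_continuous_within using d' has_vector_derivative_continuous by blast
  then show "has_prim_deriv (derivs01 f j) (derivs01 f (Suc j))" by (intro has_prim_deriv_C1 d')
qed

lemma smooth_seq_continuous: "smooth_seq \<Phi> \<Longrightarrow> continuous_on {0..1} (\<Phi> j)"
  unfolding smooth_seq_def using has_prim_deriv_continuous by blast

definition leibniz :: "(nat \<Rightarrow> real \<Rightarrow> complex) \<Rightarrow> (nat \<Rightarrow> real \<Rightarrow> complex) \<Rightarrow> nat \<Rightarrow> real \<Rightarrow> complex" where
  "leibniz \<Phi> F j x = (\<Sum>i\<le>j. of_nat (j choose i) * \<Phi> i x * F (j - i) x)"

text \<open>The derivative of Leibniz's formula of order \<open>j\<close>, taken term by term, is the formula of order \<open>j + 1\<close>.\<close>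

lemma leibniz_Suc:
  "leibniz \<Phi> F (Suc j) x = (\<Sum>i\<le>j. of_nat (j choose i) * (\<Phi> (Suc i) x * F (j - i) x + \<Phi> i x * F (Suc (j - i)) x))"
proof -
  have "leibniz \<Phi> F (Suc j) x = \<Phi> 0 x * F (Suc j) x + (\<Sum>i\<le>j. of_nat (Suc j choose Suc i) * \<Phi> (Suc i) x * F (j - i) x)"
    unfolding leibniz_def by (subst sum.atMost_Suc_shift) simp
  also have "\<dots> = (\<Sum>i\<le>j. of_nat (j choose i) * \<Phi> (Suc i) x * F (j - i) x)
     + (\<Phi> 0 x * F (Suc j) x + (\<Sum>i\<le>j. of_nat (j choose Suc i) * \<Phi> (Suc i) x * F (j - i) x))"
    by (simp add: algebra_simps sum.distrib)
  also have "\<Phi> 0 x * F (Suc j) x + (\<Sum>i\<le>j. of_nat (j choose Suc i) * \<Phi> (Suc i) x * F (j - i) x) =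
     (\<Sum>i\<le>Suc j. of_nat (j choose i) * \<Phi> i x * F (Suc j - i) x)"
    by (subst sum.atMost_Suc_shift) simp
  also have "\<dots> = (\<Sum>i\<le>j. of_nat (j choose i) * \<Phi> i x * F (Suc (j - i)) x)"
    by (simp add: Suc_diff_le)
  finally show ?thesis by (simp add: algebra_simps sum.distrib)
qed

lemma deriv_chain_leibniz:
  assumes F: "deriv_chain m F" and \<Phi>: "smooth_seq \<Phi>"
  shows "deriv_chain m (leibniz \<Phi> F)"
  unfolding deriv_chain_def
proof (intro conjI allI impI)
  fix j assume j: "j \<le> m"
  have "(\<lambda>x. \<Sum>i\<le>j. of_nat (j choose i) * (\<Phi> i x * F (j - i) x)) \<in> L2_01"
  proof (intro L2_sum L2_cmult L2_mult_continuous smooth_seq_continuous[OF \<Phi>])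
    show "F (j - i) \<in> L2_01" for i using F j unfolding deriv_chain_def by auto
  qed
  then show "leibniz \<Phi> F j \<in> L2_01" by (rule L2_cong) (simp add: leibniz_def mult.assoc)
next
  fix j assume j: "j < m"
  have "has_prim_deriv (\<lambda>x. \<Sum>i\<le>j. of_nat (j choose i) * (\<Phi> i x * F (j - i) x))
    (\<lambda>x. \<Sum>i\<le>j. of_nat (j choose i) * (\<Phi> (Suc i) x * F (j - i) x + \<Phi> i x * F (Suc (j - i)) x))"
  proof (intro has_prim_deriv_sum has_prim_deriv_cmult has_prim_deriv_mult)
    fix i
    show "has_prim_deriv (\<Phi> i) (\<Phi> (Suc i))" using \<Phi> unfolding smooth_seq_def by blast
    show "has_prim_deriv (F (j - i)) (F (Suc (j - i)))" using F j unfolding deriv_chain_def by auto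
  qed
  then show "has_prim_deriv (leibniz \<Phi> F j) (leibniz \<Phi> F (Suc j))"
    unfolding leibniz_Suc[abs_def] by (simp add: leibniz_def[abs_def] mult.assoc)
qed

lemma deriv_chain_add: "deriv_chain m F \<Longrightarrow> deriv_chain m G \<Longrightarrow> deriv_chain m (\<lambda>j x. F j x + G j x)"
  unfolding deriv_chain_def by (auto intro: L2_add has_prim_deriv_add)

lemma deriv_chain_cmult: "deriv_chain m F \<Longrightarrow> deriv_chain m (\<lambda>j x. c * F j x)"
  unfolding deriv_chain_def by (auto intro: L2_cmult has_prim_deriv_cmult)

lemma deriv_chain_sum: "(\<And>i. i \<in> I \<Longrightarrow> deriv_chain m (F i)) \<Longrightarrow> deriv_chain m (\<lambda>j x. \<Sum>i\<in>I. F i j x)"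
  unfolding deriv_chain_def by (auto intro!: L2_sum has_prim_deriv_sum)

lemma deriv_chain_mono: "deriv_chain m F \<Longrightarrow> k \<le> m \<Longrightarrow> deriv_chain k F"
  unfolding deriv_chain_def by auto

lemma deriv_chain_shift: "deriv_chain (m + k) F \<Longrightarrow> deriv_chain m (\<lambda>j. F (j + k))"
  unfolding deriv_chain_def by auto

definition jets01 :: "(real \<Rightarrow> real) \<Rightarrow> real \<Rightarrow> nat \<Rightarrow> real" where
  "jets01 V y i = nderiv_within {0..1} i V y"

text \<open>On chains the Schroedinger operator is given by Leibniz's formula in every order, so on the jet at any point it
is exactly \<open>jet_schr\<close>.\<close>

lemma sobolev_rep_schroedinger:
  assumes F: "sobolev_rep (m + 2) u F" and V: "smooth_within {0..1} V"
  defines "G \<equiv> \<lambda>j x. F (j + 2) x + leibniz (derivs01 V) F j x"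
  shows "sobolev_rep m (schroedinger V u) G" "(\<lambda>j. G j y) = jet_schr (jets01 V y) (\<lambda>j. F j y)"
proof -
  have c: "deriv_chain (m + 2) F" using F unfolding sobolev_rep_def by blast
  have "deriv_chain m G" unfolding G_def
    by (intro deriv_chain_add deriv_chain_shift c deriv_chain_leibniz deriv_chain_mono[OF c] smooth_seq_derivs01 V) simp
  moreover have "AE x in leb01. schroedinger V u x = G 0 x"
    using weak_deriv_sobolev_rep[OF F, of 2, OF le_add2] F[unfolded sobolev_rep_def, THEN conjunct2]
    by eventually_elim (simp add: schroedinger_def G_def leibniz_def derivs01_def numeral_2_eq_2)
  ultimately show "sobolev_rep m (schroedinger V u) G" unfolding sobolev_rep_def by blast
  show "(\<lambda>j. G j y) = jet_schr (jets01 V y) (\<lambda>j. F j y)"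
    by (rule ext) (simp add: G_def jet_schr_def jets01_def leibniz_def derivs01_def)
qed

lemma sobolev_rep_schroedinger_power:
  assumes V: "smooth_within {0..1} V"
  shows "sobolev_rep (m + 2 * l) u F \<Longrightarrow> \<exists>G. sobolev_rep m ((schroedinger V ^^ l) u) G \<and>
    (\<forall>y. (\<lambda>j. G j y) = (jet_schr (jets01 V y) ^^ l) (\<lambda>j. F j y))"
proof (induction l arbitrary: m)
  case 0
  then show ?case by (intro exI[of _ F]) simp
next
  case (Suc l)
  have "sobolev_rep ((m + 2) + 2 * l) u F" using Suc.prems by simp
  then obtain G where G: "sobolev_rep (m + 2) ((schroedinger V ^^ l) u) G"
    "\<And>y. (\<lambda>j. G j y) = (jet_schr (jets01 V y) ^^ l) (\<lambda>j. F j y)" using Suc.IH by blast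
  show ?case
    using sobolev_rep_schroedinger[OF G(1) V] G(2)
    by (intro exI[of _ "\<lambda>j x. G (j + 2) x + leibniz (derivs01 V) G j x"]) simp
qed

lemma H_V_I:
  assumes V: "smooth_within {0..1} V" and F: "sobolev_rep (2 * a) u F"
    and 0: "\<And>l y. l < a \<Longrightarrow> y \<in> {0, 1} \<Longrightarrow> (jet_schr (jets01 V y) ^^ l) (\<lambda>j. F j y) 0 = 0"
  shows "u \<in> H_V V a"
proof -
  have "trace_at ((schroedinger V ^^ l) u) y = 0" if l: "l < a" and y: "y \<in> {0, 1}" for l y
  proof -
    have "sobolev_rep ((2 * a - 2 * l) + 2 * l) u F" using F l by simp
    from sobolev_rep_schroedinger_power[OF V this] obtain G where G: "sobolev_rep (2 * a - 2 * l) ((schroedinger V ^^ l) u) G"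
      "\<And>y. (\<lambda>j. G j y) = (jet_schr (jets01 V y) ^^ l) (\<lambda>j. F j y)" by blast
    have "trace_at ((schroedinger V ^^ l) u) y = G 0 y"
      by (rule trace_at_sobolev_rep[OF G(1)]) (use l y in auto)
    also have "\<dots> = 0" using 0[OF l y] fun_cong[OF G(2)[of y], of 0] by simp
    finally show ?thesis .
  qed
  then show ?thesis unfolding H_V_def using sobolev_rep_imp_sobolev[OF F] by simp
qed

lemma H_Dir_E:
  assumes "u \<in> H_Dir a"
  obtains F where "sobolev_rep (2 * a) u F" "\<And>l y. l < a \<Longrightarrow> y \<in> {0, 1} \<Longrightarrow> F (2 * l) y = 0"
proof -
  obtain F where F: "sobolev_rep (2 * a) u F" using assms sobolev_imp_sobolev_rep unfolding H_Dir_def by blast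
  have "F (2 * l) y = 0" if l: "l < a" and y: "y \<in> {0, 1}" for l y
  proof -
    have c: "deriv_chain (2 * a) F" using F unfolding sobolev_rep_def by blast
    have "deriv_chain (2 * a - 2 * l) (\<lambda>j. F (j + 2 * l))" by (rule deriv_chain_shift) (use c l in simp)
    then have "sobolev_rep (2 * a - 2 * l) (weak_deriv (2 * l) u) (\<lambda>j. F (j + 2 * l))"
      unfolding sobolev_rep_def using weak_deriv_sobolev_rep[OF F, of "2 * l"] l by simp
    then have "trace_at (weak_deriv (2 * l) u) y = F (0 + 2 * l) y"
      by (rule trace_at_sobolev_rep) (use l y in auto)
    then show ?thesis using assms l y unfolding H_Dir_def by auto
  qed
  then show thesis using that F by blast
qed

section \<open>Iterated integrals and the corrector\<close>

lemma set_integral_open: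
  fixes f :: "real \<Rightarrow> complex"
  assumes f: "integrable leb01 f" and ab: "0 \<le> a" "a \<le> b" "b \<le> 1"
  shows "(LINT z:{a<..<b}|lebesgue. f z) = integral {a..b} f"
proof -
  have "f absolutely_integrable_on {0..1}"
    using f by (simp add: set_integrable_def integrable_restrict_space)
  then have "f absolutely_integrable_on {a<..<b}" by (rule set_integrable_subset) (use ab in auto)
  from set_lebesgue_integral_eq_integral(2)[OF this] show ?thesis by (simp add: integral_open_interval_real)
qed

lemma oriented_integral:
  fixes f :: "real \<Rightarrow> complex"
  assumes f: "integrable leb01 f" and y: "y \<in> {0..1}" and x: "x \<in> {0..1}"
  shows "(LINT z=ereal y..ereal x|lebesgue. f z) = integral {0..x} f - integral {0..y} f"
proof -
  have combine: "integral {0..a} f + integral {a..b} f = integral {0..b} f" if "0 \<le> a" "a \<le> b" "b \<le> 1" for a b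
    by (rule Henstock_Kurzweil_Integration.integral_combine) (use that integrable_leb01_on[OF f] in auto)
  show ?thesis
    using x y combine[of y x] combine[of x y] set_integral_open[OF f]
    by (auto simp: interval_lebesgue_integral_def algebra_simps)
qed

lemma iter_int_prim:
  assumes "integrable leb01 (iter_int n y u)" "y \<in> {0..1}"
  shows "has_prim_deriv (iter_int (Suc n) y u) (iter_int n y u)" "iter_int (Suc n) y u y = 0"
proof -
  note o = oriented_integral[OF assms]
  show "has_prim_deriv (iter_int (Suc n) y u) (iter_int n y u)"
    by (rule has_prim_derivI[OF assms(1)]) (simp add: o)
  show "iter_int (Suc n) y u y = 0" using o[OF assms(2)] by simp
qed

lemma integrable_iter_int:
  assumes "integrable leb01 u" "y \<in> {0..1}" shows "integrable leb01 (iter_int n y u)"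
proof (induction n)
  case (Suc n)
  from iter_int_prim(1)[OF this assms(2)] show ?case
    by (intro continuous_integrable_leb01 has_prim_deriv_continuous)
qed (use assms in simp)

lemmas iter_int_facts = iter_int_prim[OF integrable_iter_int]

text \<open>The derivatives of the \<open>n\<close>-fold primitive of \<open>u\<close> are the primitives of lower multiplicity, followed by the
derivatives \<open>F\<close> of \<open>u\<close>. The primitives all vanish at their base point \<open>y\<close>.\<close>

definition iter_int_chain :: "nat \<Rightarrow> real \<Rightarrow> (real \<Rightarrow> complex) \<Rightarrow> (nat \<Rightarrow> real \<Rightarrow> complex) \<Rightarrow> nat \<Rightarrow> real \<Rightarrow> complex" where
  "iter_int_chain n y u F j = (if j < n then iter_int (n - j) y u else F (j - n))"

lemma deriv_chain_iter_int_chain: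
  assumes F: "sobolev_rep m u F" and y: "y \<in> {0..1}"
  shows "deriv_chain (m + n) (iter_int_chain n y u F)"
proof -
  have u: "integrable leb01 u" by (rule L2_integrable[OF sobolev_rep_L2[OF F]])
  have c: "deriv_chain m F" and ae: "AE x in leb01. u x = F 0 x" using F unfolding sobolev_rep_def by auto
  show ?thesis
    unfolding deriv_chain_def
  proof (intro conjI allI impI)
    fix j assume j: "j \<le> m + n"
    show "iter_int_chain n y u F j \<in> L2_01"
    proof (cases "j < n")
      case True
      then obtain k where "n - j = Suc k" by (metis Suc_diff_Suc)
      then show ?thesis using True has_prim_deriv_continuous[OF iter_int_facts(1)[OF u y y, of k]]
        by (simp add: iter_int_chain_def L2_continuous)
    next
      case False
      then show ?thesis using c j by (simp add: iter_int_chain_def deriv_chain_def)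
    qed
  next
    fix j assume j: "j < m + n"
    consider "Suc j < n" | "Suc j = n" | "n \<le> j" by linarith
    then show "has_prim_deriv (iter_int_chain n y u F j) (iter_int_chain n y u F (Suc j))"
    proof cases
      case 1
      then have "n - j = Suc (n - Suc j)" by simp
      then show ?thesis using 1 iter_int_facts(1)[OF u y y, of "n - Suc j"] by (simp add: iter_int_chain_def)
    next
      case 2
      have "has_prim_deriv (iter_int (Suc 0) y u) (F 0)"
        by (rule has_prim_deriv_AE[OF iter_int_facts(1)[OF u y y, of 0] refl]) (simp add: ae)
      then show ?thesis using 2 by (auto simp: iter_int_chain_def)
    next
      case 3
      then have "Suc j - n = Suc (j - n)" "j - n < m" using j by auto
      then show ?thesis using 3 c by (simp add: iter_int_chain_def deriv_chain_def)
    qed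
  qed
qed

lemma iter_int_chain_at:
  assumes F: "sobolev_rep m u F" and y: "y \<in> {0..1}"
  shows "iter_int_chain n y u F j y = (if j < n then 0 else F (j - n) y)"
proof (cases "j < n")
  case True
  then obtain k where "n - j = Suc k" by (metis Suc_diff_Suc)
  then show ?thesis using True iter_int_facts(2)[OF L2_integrable[OF sobolev_rep_L2[OF F]] y y, of k] by (simp add: iter_int_chain_def)
qed (simp add: iter_int_chain_def)

definition corrector_chain :: "(nat \<Rightarrow> nat \<Rightarrow> real \<Rightarrow> real) \<Rightarrow> (nat \<Rightarrow> nat \<Rightarrow> nat \<Rightarrow> real) \<Rightarrow> nat \<Rightarrow>
    (real \<Rightarrow> complex) \<Rightarrow> (nat \<Rightarrow> real \<Rightarrow> complex) \<Rightarrow> nat \<Rightarrow> real \<Rightarrow> complex" where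
  "corrector_chain \<phi> \<alpha> k u F j x = (\<Sum>y\<in>{0, 1}. \<Sum>i = 1..k - 1. \<Sum>n = 1..2 * i + 1.
     of_real (\<alpha> i n y) * leibniz (derivs01 (\<phi> (2 * i + 1 - n) y)) (iter_int_chain n (real y) u F) j x)"

lemma corrector_eq_corrector_chain: "corrector \<phi> \<alpha> k u x = corrector_chain \<phi> \<alpha> k u F 0 x"
  unfolding corrector_def corrector_chain_def
  by (intro sum.cong) (auto simp: leibniz_def iter_int_chain_def derivs01_def mult.assoc)

text \<open>Every term of the corrector contains at least one integration, which gains one derivative.\<close>

lemma sobolev_rep_corrector:
  assumes F: "sobolev_rep m u F" and \<phi>: "\<And>n y. y \<in> {0, 1} \<Longrightarrow> smooth_within {0..1} (\<phi> n y)"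
  shows "sobolev_rep (Suc m) (corrector \<phi> \<alpha> k u) (corrector_chain \<phi> \<alpha> k u F)"
proof -
  have "deriv_chain (Suc m) (corrector_chain \<phi> \<alpha> k u F)"
    unfolding corrector_chain_def[abs_def]
  proof (intro deriv_chain_sum deriv_chain_cmult deriv_chain_leibniz smooth_seq_derivs01 \<phi>)
    fix y i n :: nat assume "y \<in> {0, 1}" "n \<in> {1..2 * i + 1}"
    then show "deriv_chain (Suc m) (iter_int_chain n (real y) u F)"
      by (intro deriv_chain_mono[OF deriv_chain_iter_int_chain[OF F]]) auto
  qed
  then show ?thesis unfolding sobolev_rep_def using corrector_eq_corrector_chain[of \<phi> \<alpha> k u _ F] by simp
qed

text \<open>At the endpoint \<open>z\<close> only the terms with \<open>y = z\<close> survive, and in Leibniz's formula for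
\<open>\<phi> (2 * i + 1 - n) z\<close> only one summand. The bound \<open>j \<le> 2 * k\<close> ensures that the corrector contains all shifts
by at most \<open>j\<close>.\<close>

lemma corrector_chain_at:
  fixes z :: nat
  assumes F: "sobolev_rep m u F" and z: "z \<in> {0, 1}"
    and flat: "\<And>n y z i. y \<in> {0, 1} \<Longrightarrow> z \<in> {0, 1} \<Longrightarrow>
           nderiv_within {0..1} i (\<phi> n y) (real z) = (if z = y \<and> i = n then 1 else 0)"
    and P: "\<And>i x. P i x = (\<Sum>n = 1..2 * i + 1. \<alpha> i n z * (x gchoose (2 * i + 1 - n)))"
    and j: "j \<le> 2 * k"
  shows "corrector_chain \<phi> \<alpha> k u F j (real z) = jet_corr P (\<lambda>j. F j (real z)) j"
proof -
  have L: "leibniz (derivs01 (\<phi> p y)) G j (real z) = (if y = z \<and> p \<le> j then of_nat (j choose p) * G (j - p) (real z) else 0)"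
    if "y \<in> {0, 1}" for p y and G :: "nat \<Rightarrow> real \<Rightarrow> complex"
  proof -
    have "leibniz (derivs01 (\<phi> p y)) G j (real z) =
      (\<Sum>i\<le>j. if i = p then (if y = z then of_nat (j choose p) * G (j - p) (real z) else 0) else 0)"
      unfolding leibniz_def derivs01_def by (intro sum.cong refl) (auto simp: flat[OF that z])
    then show ?thesis by (simp add: sum.delta)
  qed
  have T: "of_real (\<alpha> i n z) * leibniz (derivs01 (\<phi> (2 * i + 1 - n) z)) (iter_int_chain n (real z) u F) j (real z) =
     (if 2 * i + 1 \<le> j then of_real (\<alpha> i n z * (real j gchoose (2 * i + 1 - n))) * F (j - (2 * i + 1)) (real z) else 0)"
    if n: "n \<in> {1..2 * i + 1}" for i n
  proof -
    have z01: "real z \<in> {0..1}" using z by auto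
    have "j - (2 * i + 1 - n) - n = j - (2 * i + 1)" using n by auto
    moreover have "j - (2 * i + 1 - n) < n \<longleftrightarrow> \<not> 2 * i + 1 \<le> j" if "2 * i + 1 - n \<le> j" using n that by auto
    ultimately show ?thesis
      unfolding L[OF z] iter_int_chain_at[OF F z01] using n
      by (auto simp: binomial_gbinomial[symmetric] simp del: binomial_gbinomial)
  qed
  have "corrector_chain \<phi> \<alpha> k u F j (real z) = (\<Sum>y\<in>{0, 1}. if y = z then (\<Sum>i = 1..k - 1. \<Sum>n = 1..2 * i + 1.
     of_real (\<alpha> i n z) * leibniz (derivs01 (\<phi> (2 * i + 1 - n) z)) (iter_int_chain n (real z) u F) j (real z)) else 0)"
    unfolding corrector_chain_def
  proof (intro sum.cong refl)
    fix y :: nat assume y: "y \<in> {0, 1}"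
    show "(\<Sum>i = 1..k - 1. \<Sum>n = 1..2 * i + 1.
        of_real (\<alpha> i n y) * leibniz (derivs01 (\<phi> (2 * i + 1 - n) y)) (iter_int_chain n (real y) u F) j (real z)) =
      (if y = z then (\<Sum>i = 1..k - 1. \<Sum>n = 1..2 * i + 1.
        of_real (\<alpha> i n z) * leibniz (derivs01 (\<phi> (2 * i + 1 - n) z)) (iter_int_chain n (real z) u F) j (real z)) else 0)"
      by (cases "y = z") (simp_all only: L[OF y] if_True if_False simp_thms mult_zero_right sum.neutral_const refl)
  qed
  also have "\<dots> = (\<Sum>i = 1..k - 1. \<Sum>n = 1..2 * i + 1.
     of_real (\<alpha> i n z) * leibniz (derivs01 (\<phi> (2 * i + 1 - n) z)) (iter_int_chain n (real z) u F) j (real z))"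
    using z by (simp add: sum.delta)
  also have "\<dots> = (\<Sum>i = 1..k - 1. if 2 * i + 1 \<le> j then of_real (P i (real j)) * F (j - (2 * i + 1)) (real z) else 0)"
  proof (intro sum.cong refl)
    fix i
    have "(\<Sum>n = 1..2 * i + 1. of_real (\<alpha> i n z) * leibniz (derivs01 (\<phi> (2 * i + 1 - n) z)) (iter_int_chain n (real z) u F) j (real z))
      = (\<Sum>n = 1..2 * i + 1. if 2 * i + 1 \<le> j then of_real (\<alpha> i n z * (real j gchoose (2 * i + 1 - n))) * F (j - (2 * i + 1)) (real z) else 0)"
      by (intro sum.cong refl T)
    also have "\<dots> = (if 2 * i + 1 \<le> j then of_real (P i (real j)) * F (j - (2 * i + 1)) (real z) else 0)"
      unfolding P of_real_sum by (simp only: sum_distrib_right split: if_split) simp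
    finally show "(\<Sum>n = 1..2 * i + 1. of_real (\<alpha> i n z) * leibniz (derivs01 (\<phi> (2 * i + 1 - n) z)) (iter_int_chain n (real z) u F) j (real z)) =
      (if 2 * i + 1 \<le> j then of_real (P i (real j)) * F (j - (2 * i + 1)) (real z) else 0)" .
  qed
  also have "\<dots> = jet_corr P (\<lambda>j. F j (real z)) j"
    unfolding jet_corr_def by (rule sum.mono_neutral_cong_right) (use j in auto)
  finally show ?thesis .
qed

text \<open>In order \<open>j\<close> the action on jets reads only smaller orders, so its description up to order \<open>2 * k\<close> survives
iteration.\<close>

lemma sobolev_rep_corrector_power:
  assumes \<phi>: "\<And>n y. y \<in> {0, 1} \<Longrightarrow> smooth_within {0..1} (\<phi> n y)"
    and flat: "\<And>n y z i. y \<in> {0, 1} \<Longrightarrow> z \<in> {0, 1} \<Longrightarrow>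
           nderiv_within {0..1} i (\<phi> n y) (real z) = (if z = y \<and> i = n then 1 else 0)"
    and P: "\<And>z i x. z \<in> {0, 1} \<Longrightarrow> P z i x = (\<Sum>n = 1..2 * i + 1. \<alpha> i n z * (x gchoose (2 * i + 1 - n)))"
    and F: "sobolev_rep m u F"
  shows "\<exists>G. sobolev_rep (m + N) ((corrector \<phi> \<alpha> k ^^ N) u) G \<and>
     (\<forall>z\<in>{0, 1}. \<forall>j\<le>2 * k. G j (real z) = (jet_corr (P z) ^^ N) (\<lambda>j. F j (real z)) j)"
proof (induction N)
  case 0
  then show ?case using F by auto
next
  case (Suc N)
  then obtain G where G: "sobolev_rep (m + N) ((corrector \<phi> \<alpha> k ^^ N) u) G"
    "\<And>z j. z \<in> {0, 1} \<Longrightarrow> j \<le> 2 * k \<Longrightarrow> G j (real z) = (jet_corr (P z) ^^ N) (\<lambda>j. F j (real z)) j" by blast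
  have "sobolev_rep (m + Suc N) ((corrector \<phi> \<alpha> k ^^ Suc N) u) (corrector_chain \<phi> \<alpha> k ((corrector \<phi> \<alpha> k ^^ N) u) G)"
    using sobolev_rep_corrector[OF G(1) \<phi>] by simp
  moreover have "corrector_chain \<phi> \<alpha> k ((corrector \<phi> \<alpha> k ^^ N) u) G j (real z) = (jet_corr (P z) ^^ Suc N) (\<lambda>j. F j (real z)) j"
    if z: "z \<in> {0, 1}" and j: "j \<le> 2 * k" for z j
  proof -
    have "corrector_chain \<phi> \<alpha> k ((corrector \<phi> \<alpha> k ^^ N) u) G j (real z) = jet_corr (P z) (\<lambda>j. G j (real z)) j"
      by (rule corrector_chain_at[where P = "P z", OF G(1) z _ _ j]) (rule flat P[OF z]; assumption)+
    also have "\<dots> = jet_corr (P z) ((jet_corr (P z) ^^ N) (\<lambda>j. F j (real z))) j"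
      by (rule jet_corr_cong) (use G(2)[OF z] j in simp)
    finally show ?thesis by simp
  qed
  ultimately show ?case by blast
qed

section \<open>The exponential series\<close>

text \<open>The series of the functions \<open>t j\<close> has the sum \<open>w\<close> and is majorized on the unit interval by the convergent series
of the numbers \<open>B j\<close> (the hypothesis of the Weierstrass test).\<close>

definition dominated_series :: "(nat \<Rightarrow> real \<Rightarrow> complex) \<Rightarrow> (nat \<Rightarrow> real) \<Rightarrow> (real \<Rightarrow> complex) \<Rightarrow> bool" where
  "dominated_series t B w \<longleftrightarrow> (\<forall>j. t j \<in> borel_measurable leb01) \<and> (\<forall>j. \<forall>x\<in>{0..1}. norm (t j x) \<le> B j) \<and>
     summable B \<and> (\<forall>x\<in>{0..1}. (\<lambda>j. t j x) sums w x)"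

lemma dominated_seriesD:
  assumes "dominated_series t B w"
  shows "t j \<in> borel_measurable leb01" "x \<in> {0..1} \<Longrightarrow> norm (t j x) \<le> B j" "summable B"
    "x \<in> {0..1} \<Longrightarrow> (\<lambda>j. t j x) sums w x"
  using assms unfolding dominated_series_def by simp_all

lemma dominated_series_integrable: "dominated_series t B w \<Longrightarrow> integrable leb01 (t j)"
  by (rule integrable_leb01_bounded[OF dominated_seriesD(1) dominated_seriesD(2)])

lemma dominated_series_limit_measurable:
  assumes "dominated_series t B w" shows "w \<in> borel_measurable leb01"
proof (rule borel_measurable_LIMSEQ_metric)
  show "(\<lambda>x. \<Sum>j<n. t j x) \<in> borel_measurable leb01" for n
    using dominated_seriesD(1)[OF assms] by measurable
  show "(\<lambda>n. \<Sum>j<n. t j x) \<longlonglongrightarrow> w x" if "x \<in> space leb01" for x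
    using dominated_seriesD(4)[OF assms, of x] that by (simp add: sums_def)
qed

lemma dominated_series_limit_bounded:
  assumes "dominated_series t B w" "x \<in> {0..1}" shows "norm (w x) \<le> suminf B"
proof -
  have "summable (\<lambda>j. norm (t j x))"
    by (rule summable_comparison_test'[OF dominated_seriesD(3)[OF assms(1)]]) (use dominated_seriesD(2)[OF assms] in simp)
  then have "norm (\<Sum>j. t j x) \<le> (\<Sum>j. norm (t j x))" by (rule summable_norm)
  also have "\<dots> \<le> suminf B" by (rule suminf_le[OF dominated_seriesD(2)[OF assms] \<open>summable _\<close> dominated_seriesD(3)[OF assms(1)]])
  finally show ?thesis using dominated_seriesD(4)[OF assms] by (simp add: sums_iff)
qed

lemma dominated_series_limit_integrable: "dominated_series t B w \<Longrightarrow> integrable leb01 w"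
  by (rule integrable_leb01_bounded[OF dominated_series_limit_measurable dominated_series_limit_bounded])

lemma dominated_series_integral:
  assumes t: "dominated_series t B w" and x: "x \<in> {0..1}"
  shows "(\<lambda>j. integral {0..x} (t j)) sums integral {0..x} w"
    "norm (integral {0..x} (t j)) \<le> B j"
proof -
  let ?M = "lebesgue_on {0..x}"
  have bound: "norm (integral {0..x} f) \<le> b"
    if f: "integrable leb01 f" and b: "\<And>x. x \<in> {0..1} \<Longrightarrow> norm (f x) \<le> b" for f :: "real \<Rightarrow> complex" and b
  proof -
    have b0: "0 \<le> b" using order_trans[OF norm_ge_zero b[of 0]] by simp
    have "norm (integral {0..x} f) \<le> b * measure lborel {0..x}"
      by (rule has_integral_bound_real[OF b0 finite.emptyI integrable_integral[OF integrable_leb01_on[OF f x]]]) (use b x in auto)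
    also have "\<dots> \<le> b * 1" by (rule mult_left_mono) (use x b0 in auto)
    finally show ?thesis by simp
  qed
  show "norm (integral {0..x} (t j)) \<le> B j" by (rule bound[OF dominated_series_integrable[OF t] dominated_seriesD(2)[OF t]])
  have sub: "s \<in> {0..1}" if "s \<in> space ?M" for s using that x by auto
  have summable_norm: "summable (\<lambda>j. norm (t j s))" if "s \<in> {0..1}" for s
    by (rule summable_comparison_test'[OF dominated_seriesD(3)[OF t]]) (use dominated_seriesD(2)[OF t that] in simp)
  have "(\<lambda>j. integral\<^sup>L ?M (t j)) sums (LINT s|?M. (\<Sum>j. t j s))"
  proof (rule sums_integral)
    show "integrable ?M (t j)" for j by (rule integrable_leb01_sub[OF dominated_series_integrable[OF t] x])
    show "AE s in ?M. summable (\<lambda>j. norm (t j s))" using summable_norm sub by (intro AE_I2) blast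
    show "summable (\<lambda>j. LINT s|?M. norm (t j s))"
    proof (rule summable_comparison_test'[OF dominated_seriesD(3)[OF t]])
      fix j
      have i: "integrable leb01 (\<lambda>s. complex_of_real (norm (t j s)))" using dominated_series_integrable[OF t] by simp
      have "norm (integral {0..x} (\<lambda>s. complex_of_real (norm (t j s)))) \<le> B j"
        by (rule bound[OF i]) (simp add: dominated_seriesD(2)[OF t])
      also have "integral {0..x} (\<lambda>s. complex_of_real (norm (t j s))) = of_real (LINT s|?M. norm (t j s))"
        unfolding integral_leb01_sub[OF i x, symmetric] by simp
      finally show "norm (LINT s|?M. norm (t j s)) \<le> B j" by simp
    qed
  qed
  moreover have "(LINT s|?M. (\<Sum>j. t j s)) = integral\<^sup>L ?M w"
    by (rule Bochner_Integration.integral_cong[OF refl]) (use dominated_seriesD(4)[OF t sub] in \<open>simp add: sums_iff\<close>)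
  ultimately show "(\<lambda>j. integral {0..x} (t j)) sums integral {0..x} w"
    by (simp add: integral_leb01_sub[OF dominated_series_integrable[OF t] x] integral_leb01_sub[OF dominated_series_limit_integrable[OF t] x])
qed

text \<open>\<open>S\<close> is bounded by \<open>M\<close> in the supremum norm and may be applied to majorized series term by term. This
combination is stable under the operations that build the corrector.\<close>

definition series_bounded :: "real \<Rightarrow> ((real \<Rightarrow> complex) \<Rightarrow> real \<Rightarrow> complex) \<Rightarrow> bool" where
  "series_bounded M S \<longleftrightarrow> M \<ge> 0 \<and> (\<forall>t B w. dominated_series t B w \<longrightarrow> dominated_series (\<lambda>j. S (t j)) (\<lambda>j. M * B j) (S w))"

text \<open>An integral from \<open>y\<close> is a difference of two integrals from 0, each bounded by the supremum; hence the
factor 2 in each step.\<close>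

lemma series_bounded_iter_int:
  assumes y: "y \<in> {0..1}" shows "series_bounded (2 ^ n) (iter_int n y)"
  unfolding series_bounded_def
proof (intro conjI allI impI)
  fix t B w assume t: "dominated_series t B w"
  show "dominated_series (\<lambda>j. iter_int n y (t j)) (\<lambda>j. 2 ^ n * B j) (iter_int n y w)"
  proof (induction n)
    case 0 then show ?case using t by simp
  next
    case (Suc n)
    note IH = Suc
    have eq: "iter_int (Suc n) y f x = integral {0..x} (iter_int n y f) - integral {0..y} (iter_int n y f)"
      if "integrable leb01 f" "x \<in> {0..1}" for f x
      using oriented_integral[OF integrable_iter_int[OF that(1) y] y that(2)] by simp
    note ti = dominated_series_integrable[OF t] and wi = dominated_series_limit_integrable[OF t]
    show ?case
      unfolding dominated_series_def
    proof (intro conjI allI ballI)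
      show "iter_int (Suc n) y (t j) \<in> borel_measurable leb01" for j
        by (rule continuous_leb01_measurable[OF has_prim_deriv_continuous[OF iter_int_facts(1)[OF ti y y]]])
      fix x :: real assume x: "x \<in> {0..1}"
      show "norm (iter_int (Suc n) y (t j) x) \<le> 2 ^ Suc n * B j" for j
        unfolding eq[OF ti x] using norm_triangle_ineq4 dominated_series_integral(2)[OF IH x, of j] dominated_series_integral(2)[OF IH y, of j]
        by (rule order_trans[OF _ order_trans[OF add_mono]]) auto
      show "(\<lambda>j. iter_int (Suc n) y (t j) x) sums iter_int (Suc n) y w x"
        unfolding eq[OF ti x] eq[OF wi x] by (intro sums_diff dominated_series_integral(1)[OF IH] x y)
    next
      show "summable (\<lambda>j. 2 ^ Suc n * B j)" by (intro summable_mult dominated_seriesD(3)[OF t])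
    qed
  qed
qed simp

lemma series_bounded_mult:
  assumes S: "series_bounded M S" and c: "continuous_on {0..1} c"
  shows "\<exists>M. series_bounded M (\<lambda>u x. c x * S u x)"
proof -
  obtain K where K: "K > 0" "\<And>x. x \<in> {0..1} \<Longrightarrow> norm (c x) \<le> K" using continuous_on_unit_bound[OF c] by blast
  have "series_bounded (K * M) (\<lambda>u x. c x * S u x)"
    unfolding series_bounded_def
  proof (intro conjI allI impI)
    show "0 \<le> K * M" using K S by (simp add: series_bounded_def)
    fix t B w assume "dominated_series t B w"
    then have t: "dominated_series (\<lambda>j. S (t j)) (\<lambda>j. M * B j) (S w)" using S unfolding series_bounded_def by blast
    show "dominated_series (\<lambda>j x. c x * S (t j) x) (\<lambda>j. K * M * B j) (\<lambda>x. c x * S w x)"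
      unfolding dominated_series_def
    proof (intro conjI allI ballI)
      show "(\<lambda>x. c x * S (t j) x) \<in> borel_measurable leb01" for j
        using dominated_seriesD(1)[OF t, of j] continuous_leb01_measurable[OF c] by (rule borel_measurable_times[rotated])
      show "norm (c x * S (t j) x) \<le> K * M * B j" if x: "x \<in> {0..1}" for j x
        unfolding norm_mult mult.assoc
        by (rule mult_mono[OF K(2)[OF x] dominated_seriesD(2)[OF t x]]) (use K in auto)
      show "summable (\<lambda>j. K * M * B j)" using summable_mult[OF dominated_seriesD(3)[OF t], of K] by (simp add: mult.assoc)
      show "(\<lambda>j. c x * S (t j) x) sums (c x * S w x)" if x: "x \<in> {0..1}" for x
        by (rule sums_mult[OF dominated_seriesD(4)[OF t x]])
    qed
  qed
  then show ?thesis by blast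
qed

lemma series_bounded_sum:
  "(\<And>i. i \<in> I \<Longrightarrow> \<exists>M. series_bounded M (S i)) \<Longrightarrow> \<exists>M. series_bounded M (\<lambda>u x. \<Sum>i\<in>I. S i u x)"
proof (induction I rule: infinite_finite_induct)
  case (insert i I)
  obtain M1 where M1: "series_bounded M1 (S i)" using insert.prems by blast
  obtain M2 where M2: "series_bounded M2 (\<lambda>u x. \<Sum>i\<in>I. S i u x)" using insert by blast
  have "series_bounded (M1 + M2) (\<lambda>u x. S i u x + (\<Sum>i\<in>I. S i u x))"
    unfolding series_bounded_def
  proof (intro conjI allI impI)
    show "0 \<le> M1 + M2" using M1 M2 by (simp add: series_bounded_def)
    fix t B w assume t: "dominated_series t B w"
    have t1: "dominated_series (\<lambda>j. S i (t j)) (\<lambda>j. M1 * B j) (S i w)" using M1 t unfolding series_bounded_def by blast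
    have t2: "dominated_series (\<lambda>j x. \<Sum>i\<in>I. S i (t j) x) (\<lambda>j. M2 * B j) (\<lambda>x. \<Sum>i\<in>I. S i w x)" using M2 t unfolding series_bounded_def by blast
    show "dominated_series (\<lambda>j x. S i (t j) x + (\<Sum>i\<in>I. S i (t j) x)) (\<lambda>j. (M1 + M2) * B j) (\<lambda>x. S i w x + (\<Sum>i\<in>I. S i w x))"
      unfolding dominated_series_def
    proof (intro conjI allI ballI)
      show "(\<lambda>x. S i (t j) x + (\<Sum>i\<in>I. S i (t j) x)) \<in> borel_measurable leb01" for j
        by (rule borel_measurable_add[OF dominated_seriesD(1)[OF t1] dominated_seriesD(1)[OF t2]])
      show "norm (S i (t j) x + (\<Sum>i\<in>I. S i (t j) x)) \<le> (M1 + M2) * B j" if x: "x \<in> {0..1}" for j x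
        unfolding distrib_right by (rule norm_triangle_le[OF add_mono[OF dominated_seriesD(2)[OF t1 x] dominated_seriesD(2)[OF t2 x]]])
      show "summable (\<lambda>j. (M1 + M2) * B j)" by (intro summable_mult dominated_seriesD(3)[OF t])
      show "(\<lambda>j. S i (t j) x + (\<Sum>i\<in>I. S i (t j) x)) sums (S i w x + (\<Sum>i\<in>I. S i w x))" if x: "x \<in> {0..1}" for x
        by (rule sums_add[OF dominated_seriesD(4)[OF t1 x] dominated_seriesD(4)[OF t2 x]])
    qed
  qed
  then show ?case using insert.hyps by (auto simp: fun_eq_iff)
qed (auto simp: series_bounded_def dominated_series_def intro!: exI[of _ 0])

lemma series_bounded_power:
  assumes S: "series_bounded M S" and t: "dominated_series t B w"
  shows "dominated_series (\<lambda>j. (S ^^ N) (t j)) (\<lambda>j. M ^ N * B j) ((S ^^ N) w)"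
proof (induction N)
  case (Suc N)
  then have "dominated_series (\<lambda>j. S ((S ^^ N) (t j))) (\<lambda>j. M * (M ^ N * B j)) (S ((S ^^ N) w))"
    using S unfolding series_bounded_def by blast
  then show ?case by (simp add: mult.assoc)
qed (use t in simp)

text \<open>A single function is regarded as a series with one term.\<close>

lemma series_bounded_power_bounded:
  assumes S: "series_bounded M S" and f: "f \<in> borel_measurable leb01" "\<And>x. x \<in> {0..1} \<Longrightarrow> norm (f x) \<le> b"
  shows "(S ^^ N) f \<in> borel_measurable leb01" "x \<in> {0..1} \<Longrightarrow> norm ((S ^^ N) f x) \<le> M ^ N * b"
proof -
  have "dominated_series (\<lambda>j. if j = 0 then f else (\<lambda>x. 0)) (\<lambda>j. if j = 0 then b else 0) f"
    unfolding dominated_series_def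
  proof (intro conjI allI ballI)
    show "summable (\<lambda>j::nat. if j = 0 then b else 0)" by (rule summable_finite[of "{0}"]) auto
    show "(\<lambda>j. (if j = 0 then f else (\<lambda>x. 0)) x) sums f x" for x
      using sums_single[of 0 "\<lambda>_. f x"] by (simp add: if_distrib[of "\<lambda>g. g x"] cong: if_cong)
  qed (use f in auto)
  from series_bounded_power[OF S this, of N] have *: "dominated_series (\<lambda>j. (S ^^ N) (if j = 0 then f else (\<lambda>x. 0))) (\<lambda>j. M ^ N * (if j = 0 then b else 0)) ((S ^^ N) f)" .
  show "(S ^^ N) f \<in> borel_measurable leb01" using dominated_seriesD(1)[OF *, of 0] by simp
  show "x \<in> {0..1} \<Longrightarrow> norm ((S ^^ N) f x) \<le> M ^ N * b" using dominated_seriesD(2)[OF *, of x 0] by simp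
qed

lemma op_exp_unique:
  assumes v: "v \<in> L2_01" "(\<lambda>N. \<integral>\<^sup>+ x. ennreal ((cmod (v x - S N x))\<^sup>2) \<partial>leb01) \<longlonglongrightarrow> 0"
    and w: "w \<in> L2_01" "(\<lambda>N. \<integral>\<^sup>+ x. ennreal ((cmod (w x - S N x))\<^sup>2) \<partial>leb01) \<longlonglongrightarrow> 0"
    and S: "\<And>N. S N \<in> borel_measurable leb01"
  shows "AE x in leb01. v x = w x"
proof -
  have [measurable]: "v \<in> borel_measurable leb01" "w \<in> borel_measurable leb01" "\<And>N. S N \<in> borel_measurable leb01"
    using v w S unfolding L2_01_def by auto
  have le: "(\<integral>\<^sup>+ x. ennreal ((cmod (v x - w x))\<^sup>2) \<partial>leb01) \<le>
      2 * (\<integral>\<^sup>+ x. ennreal ((cmod (v x - S N x))\<^sup>2) \<partial>leb01) + 2 * (\<integral>\<^sup>+ x. ennreal ((cmod (w x - S N x))\<^sup>2) \<partial>leb01)" for N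
  proof -
    have "ennreal ((cmod (a - b))\<^sup>2) \<le> 2 * ennreal ((cmod (a - c))\<^sup>2) + 2 * ennreal ((cmod (b - c))\<^sup>2)" for a b c :: complex
    proof -
      have "cmod (a - b) \<le> cmod (a - c) + cmod (b - c)"
        using norm_triangle_ineq4[of "a - c" "b - c"] by simp
      then have "(cmod (a - b))\<^sup>2 \<le> (cmod (a - c) + cmod (b - c))\<^sup>2" by (rule power_mono) simp
      also have "\<dots> \<le> 2 * (cmod (a - c))\<^sup>2 + 2 * (cmod (b - c))\<^sup>2"
        using zero_le_power2[of "cmod (a - c) - cmod (b - c)"] by (simp add: power2_sum power2_diff)
      finally have "ennreal ((cmod (a - b))\<^sup>2) \<le> ennreal (2 * (cmod (a - c))\<^sup>2 + 2 * (cmod (b - c))\<^sup>2)" by (rule ennreal_leI)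
      then show ?thesis by (simp add: ennreal_mult)
    qed
    then have "(\<integral>\<^sup>+ x. ennreal ((cmod (v x - w x))\<^sup>2) \<partial>leb01) \<le>
      (\<integral>\<^sup>+ x. 2 * ennreal ((cmod (v x - S N x))\<^sup>2) + 2 * ennreal ((cmod (w x - S N x))\<^sup>2) \<partial>leb01)"
      by (intro nn_integral_mono) auto
    also have "\<dots> = 2 * (\<integral>\<^sup>+ x. ennreal ((cmod (v x - S N x))\<^sup>2) \<partial>leb01) + 2 * (\<integral>\<^sup>+ x. ennreal ((cmod (w x - S N x))\<^sup>2) \<partial>leb01)"
      by (subst nn_integral_add) (auto simp: nn_integral_cmult)
    finally show ?thesis .
  qed
  have "(\<lambda>N. 2 * (\<integral>\<^sup>+ x. ennreal ((cmod (v x - S N x))\<^sup>2) \<partial>leb01) + 2 * (\<integral>\<^sup>+ x. ennreal ((cmod (w x - S N x))\<^sup>2) \<partial>leb01))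
      \<longlonglongrightarrow> 2 * 0 + 2 * 0"
    by (intro tendsto_add ennreal_tendsto_cmult v w) auto
  from LIMSEQ_le_const[OF this] le have "(\<integral>\<^sup>+ x. ennreal ((cmod (v x - w x))\<^sup>2) \<partial>leb01) \<le> 2 * 0 + 2 * 0" by blast
  then have "(\<integral>\<^sup>+ x. ennreal ((cmod (v x - w x))\<^sup>2) \<partial>leb01) = 0" by simp
  then have "AE x in leb01. ennreal ((cmod (v x - w x))\<^sup>2) = 0" by (subst (asm) nn_integral_0_iff_AE) auto
  then show ?thesis by (rule eventually_mono) (simp add: ennreal_eq_0_iff)
qed

text \<open>The remainder of the exponential series after the terms of order up to \<open>N\<close> has the common factor \<open>T\<^sup>N\<close>, and the series that is left is
still majorized, so that \<open>T\<^sup>N\<close> may be taken out of it.\<close>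

lemma op_exp_AE:
  assumes T: "series_bounded M T" and hom: "\<And>c f. T (\<lambda>x. c * f x) = (\<lambda>x. c * T f x)"
    and u: "u \<in> L2_01" and Tu: "T u \<in> borel_measurable leb01" "\<And>x. x \<in> {0..1} \<Longrightarrow> norm (T u x) \<le> b"
  obtains w where "w \<in> L2_01"
    "AE x in leb01. op_exp T u x = (\<Sum>j<Suc N. (T ^^ j) u x / fact j) + (T ^^ N) w x"
proof -
  \<comment> \<open>\<open>u\<close> itself need not be bounded, so the uniformly convergent series starts with \<open>T u\<close>.\<close>
  define t where "t j = (T ^^ j) (T u)" for j
  have t: "t j \<in> borel_measurable leb01" "x \<in> {0..1} \<Longrightarrow> norm (t j x) \<le> M ^ j * b" for j x
    unfolding t_def using series_bounded_power_bounded[OF T Tu] by blast+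
  have M0: "M \<ge> 0" using T unfolding series_bounded_def by blast
  have b0: "b \<ge> 0" using order_trans[OF norm_ge_zero Tu(2)[of 0]] by simp
  define W where "W N x = (\<Sum>j. t j x / fact (Suc j + N))" for N x
  define C where "C N j = M ^ j * b / fact (Suc j + N)" for N j
  have W: "dominated_series (\<lambda>j x. t j x / fact (Suc j + N)) (C N) (W N)" for N
  proof -
    have sC: "summable (C N)"
    proof (rule summable_comparison_test')
      show "summable (\<lambda>j. b * (M ^ j / fact j))" using summable_exp[of M] by (intro summable_mult) (simp add: field_simps)
      show "norm (C N j) \<le> b * (M ^ j / fact j)" for j
      proof -
        have "M ^ j * b / fact (Suc j + N) \<le> M ^ j * b / fact j"
        proof (rule divide_left_mono)
          show "(fact j :: real) \<le> fact (Suc j + N)" by (rule fact_mono) simp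
          show "0 \<le> M ^ j * b" using M0 b0 by simp
          show "(0::real) < fact (Suc j + N) * fact j" by (intro mult_pos_pos fact_gt_zero)
        qed
        then show ?thesis using M0 b0 by (simp add: C_def mult.commute)
      qed
    qed
    have n: "norm (t j x / fact (Suc j + N)) \<le> C N j" if "x \<in> {0..1}" for j x
      unfolding C_def norm_divide norm_fact by (rule divide_right_mono[OF t(2)[OF that]]) simp
    show ?thesis
      unfolding dominated_series_def
    proof (intro conjI allI ballI sC n)
      show "(\<lambda>x. t j x / fact (Suc j + N)) \<in> borel_measurable leb01" for j using t(1)[of j] by measurable
      show "(\<lambda>j. t j x / fact (Suc j + N)) sums W N x" if x: "x \<in> {0..1}" for x
        unfolding W_def by (rule summable_sums, rule summable_comparison_test'[OF sC]) (rule n[OF x])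
    qed
  qed
  have homN: "(T ^^ n) (\<lambda>x. c * f x) = (\<lambda>x. c * (T ^^ n) f x)" for n c f
    by (induction n) (simp_all add: hom)
  have powT: "(T ^^ n) (t j) = (T ^^ Suc (j + n)) u" for n j
    unfolding t_def by (simp add: funpow_swap1 funpow_add[symmetric, THEN fun_cong, unfolded comp_apply] add.commute)
  have sums: "(\<lambda>j. (T ^^ j) u x / fact j) sums ((\<Sum>j<Suc n. (T ^^ j) u x / fact j) + (T ^^ n) (W n) x)"
    if x: "x \<in> {0..1}" for n x
  proof -
    have "(\<lambda>j. (T ^^ n) (\<lambda>x. (1 / fact (Suc j + n)) * t j x) x) sums (T ^^ n) (W n) x"
      using dominated_seriesD(4)[OF series_bounded_power[OF T W[of n]] x, of n] by simp
    then have "(\<lambda>j. (T ^^ (j + Suc n)) u x / fact (j + Suc n)) sums (T ^^ n) (W n) x"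
      unfolding homN powT by simp
    then show ?thesis by (subst (asm) sums_iff_shift) (simp add: add.commute)
  qed
  define v where "v x = u x + W 0 x" for x
  have v: "v \<in> L2_01" unfolding v_def[abs_def]
    by (intro L2_add u L2_bounded[OF dominated_series_limit_measurable[OF W] dominated_series_limit_bounded[OF W]])
  define S where "S n x = (\<Sum>j<n. (T ^^ j) u x / fact j)" for n x
  have S_meas: "S n \<in> borel_measurable leb01" for n
  proof -
    have [measurable]: "(T ^^ j) u \<in> borel_measurable leb01" for j
      using u t(1)[of "j - 1"] powT[of 0 "j - 1"] by (cases j) (auto simp: L2_01_def)
    show ?thesis unfolding S_def[abs_def] by measurable
  qed
  have lim: "(\<lambda>n. \<integral>\<^sup>+ x. ennreal ((cmod (v x - S n x))\<^sup>2) \<partial>leb01) \<longlonglongrightarrow> 0"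
  proof (rule LIMSEQ_imp_Suc)
    define r where "r n = (\<Sum>j. C 0 (j + n))" for n
    have "r \<longlonglongrightarrow> 0" unfolding r_def by (rule suminf_exist_split2[OF dominated_seriesD(3)[OF W]])
    then have "(\<lambda>n. ennreal ((r n)\<^sup>2)) \<longlonglongrightarrow> ennreal (0\<^sup>2)" by (intro tendsto_ennrealI tendsto_power)
    then have r0: "(\<lambda>n. ennreal ((r n)\<^sup>2)) \<longlonglongrightarrow> 0" by simp
    have "(\<integral>\<^sup>+ x. ennreal ((cmod (v x - S (Suc n) x))\<^sup>2) \<partial>leb01) \<le> ennreal ((r n)\<^sup>2)" for n
    proof -
      have "cmod (v x - S (Suc n) x) \<le> r n" if x: "x \<in> {0..1}" for x
      proof -
        have "v x = (\<Sum>j. (T ^^ j) u x / fact j)" using sums[OF x, of 0] by (simp add: v_def sums_iff)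
        moreover have sm: "summable (\<lambda>j. (T ^^ j) u x / fact j)" using sums[OF x] by (rule sums_summable)
        ultimately have "v x - S (Suc n) x = (\<Sum>j. (T ^^ (j + Suc n)) u x / fact (j + Suc n))"
          unfolding S_def by (subst suminf_minus_initial_segment[OF sm]) simp
        also have "\<dots> = (\<Sum>j. t (j + n) x / fact (Suc (j + n)))"
          using powT[of 0] by simp
        also have "norm \<dots> \<le> r n" unfolding r_def
        proof (rule norm_suminf_le)
          show "norm (t (j + n) x / fact (Suc (j + n))) \<le> C 0 (j + n)" for j
            using dominated_seriesD(2)[OF W[of 0] x, of "j + n"] by simp
          show "summable (\<lambda>j. C 0 (j + n))" using dominated_seriesD(3)[OF W[of 0]] by (rule summable_ignore_initial_segment)
        qed
        finally show ?thesis .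
      qed
      then have "(\<integral>\<^sup>+ x. ennreal ((cmod (v x - S (Suc n) x))\<^sup>2) \<partial>leb01) \<le> (\<integral>\<^sup>+ x. ennreal ((r n)\<^sup>2) \<partial>leb01)"
        by (intro nn_integral_mono ennreal_leI power_mono) auto
      also have "\<dots> = ennreal ((r n)\<^sup>2)" by (simp add: emeasure_restrict_space)
      finally show ?thesis .
    qed
    then show "(\<lambda>n. \<integral>\<^sup>+ x. ennreal ((cmod (v x - S (Suc n) x))\<^sup>2) \<partial>leb01) \<longlonglongrightarrow> 0"
      by (intro tendsto_sandwich[OF _ _ tendsto_const r0]) auto
  qed
  define e where "e = op_exp T u"
  have "e \<in> L2_01 \<and> (\<lambda>N. \<integral>\<^sup>+ x. ennreal ((cmod (e x - S N x))\<^sup>2) \<partial>leb01) \<longlonglongrightarrow> 0"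
    unfolding e_def op_exp_def S_def by (rule someI[of _ v]) (use v lim in \<open>simp add: S_def\<close>)
  then have ae: "AE x in leb01. e x = v x" using op_exp_unique[OF _ _ v lim S_meas] by blast
  have "AE x in leb01. op_exp T u x = (\<Sum>j<Suc N. (T ^^ j) u x / fact j) + (T ^^ N) (W N) x"
  proof -
    have "v x = (\<Sum>j<Suc N. (T ^^ j) u x / fact j) + (T ^^ N) (W N) x" if x: "x \<in> {0..1}" for x
      using sums_unique2[OF sums[OF x, of 0] sums[OF x, of N]] by (simp add: v_def)
    then have "AE x in leb01. v x = (\<Sum>j<Suc N. (T ^^ j) u x / fact j) + (T ^^ N) (W N) x" by (intro AE_I2) simp
    with ae show ?thesis unfolding e_def by eventually_elim simp
  qed
  moreover have "W N \<in> L2_01" by (rule L2_bounded[OF dominated_series_limit_measurable[OF W] dominated_series_limit_bounded[OF W]])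
  ultimately show thesis using that by blast
qed

lemma iter_int_cmult: "iter_int n y (\<lambda>x. c * f x) = (\<lambda>x. c * iter_int n y f x)"
  by (induction n) simp_all

lemma corrector_cmult: "corrector \<phi> \<alpha> k (\<lambda>x. c * f x) = (\<lambda>x. c * corrector \<phi> \<alpha> k f x)"
  unfolding corrector_def iter_int_cmult sum_distrib_left
  by (intro ext sum.cong refl) (simp only: mult_ac)

lemma series_bounded_corrector:
  assumes \<phi>: "\<And>n y. y \<in> {0, 1} \<Longrightarrow> smooth_within {0..1} (\<phi> n y)"
  shows "\<exists>M. series_bounded M (corrector \<phi> \<alpha> k)"
proof -
  have "\<exists>M. series_bounded M (\<lambda>u x. \<Sum>y\<in>{0, 1}. \<Sum>i = 1..k - 1. \<Sum>n = 1..2 * i + 1.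
     complex_of_real (\<alpha> i n y) * complex_of_real (\<phi> (2 * i + 1 - n) y x) * iter_int n (real y) u x)"
  proof (intro series_bounded_sum)
    fix y i n :: nat assume y: "y \<in> {0, 1}"
    have "continuous_on {0..1} (derivs01 (\<phi> (2 * i + 1 - n) y) 0)"
      by (rule smooth_seq_continuous[OF smooth_seq_derivs01[OF \<phi>[OF y]]])
    then have c: "continuous_on {0..1} (\<lambda>x. complex_of_real (\<alpha> i n y) * complex_of_real (\<phi> (2 * i + 1 - n) y x))"
      by (intro continuous_intros) (simp add: derivs01_def)
    show "\<exists>M. series_bounded M (\<lambda>u x. complex_of_real (\<alpha> i n y) * complex_of_real (\<phi> (2 * i + 1 - n) y x) * iter_int n (real y) u x)"
      by (rule series_bounded_mult[OF series_bounded_iter_int c]) (use y in auto)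
  qed
  then show ?thesis unfolding corrector_def[abs_def] .
qed

section \<open>Existence of the corrector\<close>

theorem proposition2p6:
  fixes V :: "real \<Rightarrow> real" and \<phi> :: "nat \<Rightarrow> nat \<Rightarrow> real \<Rightarrow> real"
  assumes "smooth_within {0..1} V"
    and "\<And>n y. y \<in> {0, 1} \<Longrightarrow> smooth_within {0..1} (\<phi> n y)"
    and "\<And>n y z i. y \<in> {0, 1} \<Longrightarrow> z \<in> {0, 1} \<Longrightarrow>
           nderiv_within {0..1} i (\<phi> n y) (real z) = (if z = y \<and> i = n then 1 else 0)"
  shows "\<exists>\<alpha> :: nat \<Rightarrow> nat \<Rightarrow> nat \<Rightarrow> real. \<forall>k\<ge>1.
           op_exp (corrector \<phi> \<alpha> k) ` H_Dir (k + 1) \<subseteq> H_V V (k + 1)"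
proof -
  note V = assms(1) and \<phi> = assms(2) and flat = assms(3)
  define corrects where "corrects z Q \<longleftrightarrow> (\<forall>i. polyfun (2 * i) (Q i)) \<and>
      (\<forall>l N f. 2 * l < N \<longrightarrow> (\<forall>l'\<le>l. f (2 * l') = 0) \<longrightarrow>
        (jet_schr (jets01 V (real z)) ^^ l) (\<lambda>m. \<Sum>j<N. (jet_corr Q ^^ j) f m / fact j) 0 = 0)"
    for z :: nat and Q
  have "\<exists>Q. corrects z Q" for z
  proof -
    obtain Q where "\<And>i. polyfun (2 * i) (Q i)"
      "\<And>l N f. \<lbrakk>2 * l < N; \<And>l'. l' \<le> l \<Longrightarrow> f (2 * l') = 0\<rbrakk> \<Longrightarrow>
        (jet_schr (jets01 V (real z)) ^^ l) (\<lambda>m. \<Sum>j<N. (jet_corr Q ^^ j) f m / fact j) 0 = 0"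
      by (rule exists_jet_corrector[of "jets01 V (real z)"]) blast
    then have "corrects z Q" unfolding corrects_def by simp
    then show ?thesis by blast
  qed
  then obtain P where "\<And>z. corrects z (P z)" using choice[of corrects] by blast
  then have P_poly: "\<And>z i. polyfun (2 * i) (P z i)"
    and P: "\<And>z l N f. 2 * l < N \<Longrightarrow> (\<And>l'. l' \<le> l \<Longrightarrow> f (2 * l') = 0) \<Longrightarrow>
       (jet_schr (jets01 V (real z)) ^^ l) (\<lambda>m. \<Sum>j<N. (jet_corr (P z) ^^ j) f m / fact j) 0 = 0"
    unfolding corrects_def by simp_all
  have "\<forall>z i. \<exists>c. \<forall>x. P z i x = (\<Sum>j\<le>2 * i. c j * (x gchoose j))"
    using polyfun_binomial_basis[OF P_poly] by blast
  then obtain c where c: "\<And>z i x. P z i x = (\<Sum>j\<le>2 * i. c z i j * (x gchoose j))"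
    by (auto simp: choice_iff)
  \<comment> \<open>The weight \<open>P z i\<close> in the binomial basis; \<open>(x gchoose j)\<close> comes from \<open>\<phi> j\<close>, that is, from
\<open>n = 2 * i + 1 - j\<close>.\<close>
  define \<alpha> where "\<alpha> i n y = c y i (2 * i + 1 - n)" for i n y
  have P_\<alpha>: "P z i x = (\<Sum>n = 1..2 * i + 1. \<alpha> i n z * (x gchoose (2 * i + 1 - n)))" for z i x
    unfolding c \<alpha>_def
    by (rule sum.reindex_bij_witness[of _ "\<lambda>n. 2 * i + 1 - n" "\<lambda>j. 2 * i + 1 - j"]) auto
  have "op_exp (corrector \<phi> \<alpha> k) u \<in> H_V V (k + 1)" if u: "u \<in> H_Dir (k + 1)" for k u
  proof -
    define T where "T = corrector \<phi> \<alpha> k"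
    obtain F where F: "sobolev_rep (2 * (k + 1)) u F" and F0: "\<And>l y. l < k + 1 \<Longrightarrow> y \<in> {0, 1} \<Longrightarrow> F (2 * l) y = 0"
      using H_Dir_E[OF u] by blast
    have power: "\<exists>G. sobolev_rep (m + n) ((T ^^ n) f) G \<and>
        (\<forall>z\<in>{0, 1}. \<forall>j\<le>2 * k. G j (real z) = (jet_corr (P z) ^^ n) (\<lambda>j. F' j (real z)) j)"
      if "sobolev_rep m f F'" for m n f F'
      unfolding T_def by (rule sobolev_rep_corrector_power[OF _ _ _ that]) (rule \<phi> flat P_\<alpha>; assumption)+
    obtain M where M: "series_bounded M T" unfolding T_def using series_bounded_corrector[of \<phi> \<alpha> k, OF \<phi>] by blast
    have "deriv_chain (Suc (2 * (k + 1))) (corrector_chain \<phi> \<alpha> k u F)"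
      using sobolev_rep_corrector[of _ u F \<phi> \<alpha> k, OF F \<phi>] unfolding sobolev_rep_def by blast
    then have "has_prim_deriv (corrector_chain \<phi> \<alpha> k u F 0) (corrector_chain \<phi> \<alpha> k u F (Suc 0))" unfolding deriv_chain_def by simp
    then have "continuous_on {0..1} (corrector_chain \<phi> \<alpha> k u F 0)" by (rule has_prim_deriv_continuous)
    moreover have "T u = corrector_chain \<phi> \<alpha> k u F 0" unfolding T_def by (rule ext) (rule corrector_eq_corrector_chain)
    ultimately have Tu: "continuous_on {0..1} (T u)" by simp
    obtain b where b: "\<And>x. x \<in> {0..1} \<Longrightarrow> norm (T u x) \<le> b" using continuous_on_unit_bound[OF Tu] by blast
    \<comment> \<open>\<open>N\<close> applications of \<open>T\<close> bring a merely square integrable function into \<open>H\<^sup>2\<^sup>k\<^sup>+\<^sup>2\<close>.\<close>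
    define N where "N = 2 * (k + 1)"
    have hom: "T (\<lambda>x. c * f x) = (\<lambda>x. c * T f x)" for c f unfolding T_def by (rule corrector_cmult)
    obtain w where w: "w \<in> L2_01"
      and e: "AE x in leb01. op_exp T u x = (\<Sum>j<Suc N. (T ^^ j) u x / fact j) + (T ^^ N) w x"
      by (rule op_exp_AE[OF M hom sobolev_rep_L2[OF F] continuous_leb01_measurable[OF Tu] b])
    have "\<exists>G. sobolev_rep N ((T ^^ n) u) G \<and> (\<forall>z\<in>{0, 1}. \<forall>j\<le>2 * k. G j (real z) = (jet_corr (P z) ^^ n) (\<lambda>j. F j (real z)) j)" for n
    proof -
      obtain G where G: "sobolev_rep (2 * (k + 1) + n) ((T ^^ n) u) G"
        "\<forall>z\<in>{0, 1}. \<forall>j\<le>2 * k. G j (real z) = (jet_corr (P z) ^^ n) (\<lambda>j. F j (real z)) j"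
        using power[OF F, of n] by blast
      have "sobolev_rep N ((T ^^ n) u) G" by (rule sobolev_rep_mono[OF G(1)]) (simp add: N_def)
      with G(2) show ?thesis by blast
    qed
    then have "\<forall>n. \<exists>G. sobolev_rep N ((T ^^ n) u) G \<and> (\<forall>z\<in>{0, 1}. \<forall>j\<le>2 * k. G j (real z) = (jet_corr (P z) ^^ n) (\<lambda>j. F j (real z)) j)"
      by blast
    from choice[OF this] obtain G where G: "\<And>n. sobolev_rep N ((T ^^ n) u) (G n)"
      "\<And>n z j. z \<in> {0, 1} \<Longrightarrow> j \<le> 2 * k \<Longrightarrow> G n j (real z) = (jet_corr (P z) ^^ n) (\<lambda>j. F j (real z)) j"
      by blast
    have "sobolev_rep 0 w (\<lambda>_. w)" using w by (simp add: sobolev_rep_def deriv_chain_def)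
    from power[OF this, of N] obtain H where H: "sobolev_rep N ((T ^^ N) w) H"
      "\<And>z j. z \<in> {0, 1} \<Longrightarrow> j \<le> 2 * k \<Longrightarrow> H j (real z) = (jet_corr (P z) ^^ N) (\<lambda>j. w (real z)) j" unfolding add_0 by blast
    \<comment> \<open>The remainder has vanishing jets: \<open>N\<close> shifts exceed every order up to \<open>2 * k\<close>.\<close>
    have H0: "H j (real z) = 0" if "z \<in> {0, 1}" "j \<le> 2 * k" for z j
    proof -
      have "pow_coeff (P z) N s x = 0" if "s \<le> j" for s x
        by (rule pow_coeff_eq_0) (use that \<open>j \<le> 2 * k\<close> in \<open>simp add: N_def\<close>)
      then show ?thesis unfolding H(2)[OF that] jet_corr_power by simp
    qed
    define E where "E j x = (\<Sum>n<Suc N. (1 / fact n) * G n j x) + H j x" for j x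
    have "deriv_chain N E" unfolding E_def[abs_def]
      by (intro deriv_chain_add deriv_chain_sum deriv_chain_cmult) (use G(1) H(1) in \<open>auto simp: sobolev_rep_def\<close>)
    moreover have "AE x in leb01. op_exp T u x = E 0 x"
    proof -
      have "AE x in leb01. \<forall>n. (T ^^ n) u x = G n 0 x" using G(1) unfolding sobolev_rep_def by (simp add: AE_all_countable)
      moreover have "AE x in leb01. (T ^^ N) w x = H 0 x" using H(1) unfolding sobolev_rep_def by blast
      ultimately show ?thesis using e by eventually_elim (simp add: E_def)
    qed
    ultimately have E: "sobolev_rep (2 * (k + 1)) (op_exp T u) E" unfolding sobolev_rep_def N_def by blast
    have "op_exp T u \<in> H_V V (k + 1)"
    proof (rule H_V_I[OF V E])
      fix l and y :: real assume l: "l < k + 1" and y: "y \<in> {0, 1}"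
      obtain z :: nat where z: "z \<in> {0, 1}" "y = real z" using y using that[of 0] that[of 1] by auto
      have Ez: "E j (real z) = (\<Sum>n<Suc N. (jet_corr (P z) ^^ n) (\<lambda>j. F j (real z)) j / fact n)" if "j \<le> 2 * k" for j
        unfolding E_def using G(2)[OF z(1) that] H0[OF z(1) that] by simp
      have "(jet_schr (jets01 V y) ^^ l) (\<lambda>j. E j y) 0 =
        (jet_schr (jets01 V y) ^^ l) (\<lambda>j. \<Sum>n<Suc N. (jet_corr (P z) ^^ n) (\<lambda>j. F j (real z)) j / fact n) 0"
        unfolding jet_schr_power z(2) by (intro sum.cong refl) (use l in \<open>simp add: Ez del: sum.lessThan_Suc\<close>)
      also have "\<dots> = 0" unfolding z(2)
        by (rule P) (use l F0 z y in \<open>auto simp: N_def\<close>)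
      finally show "(jet_schr (jets01 V y) ^^ l) (\<lambda>j. E j y) 0 = 0" .
    qed
    then show ?thesis unfolding T_def .
  qed
  then show ?thesis by (intro exI[of _ \<alpha>]) blast
qed

end
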